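(* Let $\Omega\subset\mathbb C$ be a connected open set and $n\ge 2$. Let $T$ on $\mathcal H=\mathcal H_0\oplus\cdots\oplus\mathcal H_{n-1}$ and $\tilde T$ on $\tilde{\mathcal H}=\tilde{\mathcal H}_0\oplus\cdots\oplus\tilde{\mathcal H}_{n-1}$ (orthogonal direct sums) be operators of the form $$T=\begin{pmatrix}T_0&S_{0\,1}&0&\cdots&0\\0&T_1&S_{1\,2}&\cdots&0\\ \vdots&\ddots&\ddots&\ddots&\vdots\\0&\cdots&0&T_{n-2}&S_{n-2\,n-1}\\0&\cdots&0&0&T_{n-1}\end{pmatrix},\qquad \tilde T=\begin{pmatrix}\tilde T_0&\tilde S_{0\,1}&0&\cdots&0\\0&\tilde T_1&\tilde S_{1\,2}&\cdots&0\\ \vdots&\ddots&\ddots&\ddots&\vdots\\0&\cdots&0&\tilde T_{n-2}&\tilde S_{n-2\,n-1}\\0&\cdots&0&0&\tilde T_{n-1}\end{pmatrix},$$ where $T_i,\tilde T_i\in B_1(\Omega)$ for $0\le i\le n-1$, and for $1\le i\le n-1$ the bounded operators $S_{i-1\,i}:\mathcal H_i\to\mathcal H_{i-1}$ and $\tilde S_{i-1\,i}:\tilde{\mathcal H}_i\to\tilde{\mathcal H}_{i-1}$ are non-zero and satisfy $T_{i-1}S_{i-1\,i}=S_{i-1\,i}T_i$ and $\tilde T_{i-1}\tilde S_{i-1\,i}=\tilde S_{i-1\,i}\tilde T_i$. Let $\{\gamma_0,t_1,\dots,t_{n-1}\}$ be an orthogonal holomorphic frame of $\bigoplus_{i=0}^{n-1}E_{T_i}$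 over $\Omega$ such that, with $t_0:=\gamma_0$, each $t_i$ is a nowhere vanishing holomorphic section of $E_{T_i}$ and $t_{i-1}=S_{i-1\,i}(t_i)$ for $1\le i\le n-1$; let $\{\tilde\gamma_0,\tilde t_1,\dots,\tilde t_{n-1}\}$ be a frame of $\bigoplus_{i=0}^{n-1}E_{\tilde T_i}$ with the same properties relative to $\tilde T$. Then $T$ and $\tilde T$ are unitarily equivalent if and only if $$\mathcal K_{T_0}=\mathcal K_{\tilde T_0}\quad\text{and}\quad\frac{\|S_{i-1\,i}(t_i)\|^2}{\|t_i\|^2}=\frac{\|\tilde S_{i-1\,i}(\tilde t_i)\|^2}{\|\tilde t_i\|^2}\ \text{ on }\Omega,\qquad 1\le i\le n-1.$$
   Context: Hilbert spaces are complex and separable. For a connected open set $\Omega\subset\mathbb C$ and $n\ge 1$, the Cowen-Douglas class $B_n(\Omega)$ consists of the bounded linear operators $T$ on a Hilbert space $\mathcal H$ such that for every $w\in\Omega$: $\dim\ker(T-w)=n$, $\operatorname{ran}(T-w)=\mathcal H$, and such that the closed linear span of $\bigcup_{w\in\Omega}\ker(T-w)$ is $\mathcal H$. For $T\in B_n(\Omega)$, $E_T$ denotes the rank $n$ holomorphic Hermitian vector bundle over $\Omega$ whose fibre at $w$ is $\ker(T-w)\subseteq\mathcal H$ (with the inner product of $\mathcal H$); its holomorphic sections are the holomorphic maps $s:\Omega\to\mathcal H$ with $s(w)\in\ker(T-w)$. For $A\in B_1(\Omega)$, the curvature is $\mathcal K_A(z)=-\frac{\partial^2}{\partial z\,\partial\bar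 z}\log\|\gamma(z)\|^2$, where $\gamma$ is any nowhere vanishing (local) holomorphic section of $E_A$; it does not depend on the choice of $\gamma$. The expression $\|S(t)\|^2/\|t\|^2$ denotes the function $w\mapsto\|S(t(w))\|^2/\|t(w)\|^2$. *)

theory Defs
  imports "HOL-Analysis.Analysis"
begin

class complex_vector = real_vector +
  fixes scaleC :: "complex \<Rightarrow> 'a \<Rightarrow> 'a"  (infixr "*\<^sub>C" 75)
  assumes scaleC_add_right: "a *\<^sub>C (x + y) = a *\<^sub>C x + a *\<^sub>C y"
    and scaleC_add_left: "(a + b) *\<^sub>C x = a *\<^sub>C x + b *\<^sub>C x"
    and scaleC_scaleC: "a *\<^sub>C (b *\<^sub>C x) = (a * b) *\<^sub>C x"
    and scaleC_one: "1 *\<^sub>C x = x"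
    and scaleR_scaleC: "r *\<^sub>R x = complex_of_real r *\<^sub>C x"

global_interpretation complex_vector:
  vector_space "scaleC :: complex \<Rightarrow> 'a \<Rightarrow> 'a::complex_vector"
  defines cdependent = complex_vector.dependent
    and csubspace = complex_vector.subspace
    and cspan = complex_vector.span
    and cdim = complex_vector.dim
  by unfold_locales (simp_all add: scaleC_add_right scaleC_add_left scaleC_scaleC scaleC_one)

text \<open>
  The complex inner product is linear in its first argument. Its real part is the inner product
  of the underlying real inner product space, so that \<open>(norm x)\<^sup>2 = Re (cinner x x)\<close>
  and positive definiteness are inherited from \<^class>\<open>real_inner\<close>.
\<close>

class complex_inner = complex_vector + real_inner +
  fixes cinner :: "'a \<Rightarrow> 'a \<Rightarrow> complex"
  assumes cinner_commute: "cinner x y = cnj (cinner y x)"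
    and cinner_add_left: "cinner (x + y) z = cinner x z + cinner y z"
    and cinner_scaleC_left: "cinner (c *\<^sub>C x) y = c * cinner x y"
    and inner_eq_Re_cinner: "inner x y = Re (cinner x y)"

class separable_hilbert = complex_inner + complete_space +
  assumes separable: "\<exists>D. countable D \<and> (\<forall>x. \<forall>e>0. \<exists>d\<in>D. norm (x - d) < e)"

instantiation complex :: separable_hilbert
begin

definition scaleC_complex :: "complex \<Rightarrow> complex \<Rightarrow> complex"
  where "scaleC_complex c x = c * x"

definition cinner_complex :: "complex \<Rightarrow> complex \<Rightarrow> complex"
  where "cinner_complex x y = x * cnj y"

instance
proof
  obtain D :: "complex set" where "countable D" and D: "\<And>X. open X \<Longrightarrow> X \<noteq> {} \<Longrightarrow> \<exists>d\<in>D. d \<in> X"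
    using countable_dense_exists by blast
  moreover have "\<exists>d\<in>D. norm (x - d) < e" if "e > 0" for x e
    using D[of "ball x e"] that by (auto simp: dist_norm)
  ultimately show "\<exists>D::complex set. countable D \<and> (\<forall>x. \<forall>e>0. \<exists>d\<in>D. norm (x - d) < e)"
    by blast
qed (auto simp: scaleC_complex_def cinner_complex_def inner_complex_def algebra_simps scaleR_conv_of_real)

end

text \<open>
  The summands of an orthogonal direct sum are represented as closed subspaces of the sum. An
  operator from a subspace \<open>H\<close> to a subspace \<open>K\<close> is a function on the
  ambient types of which only the values on \<open>H\<close> matter.
\<close>

definition bounded_op :: "'a::complex_inner set \<Rightarrow> 'b::complex_inner set \<Rightarrow> ('a \<Rightarrow> 'b) \<Rightarrow> bool"
  where "bounded_op H K A \<longleftrightarrow>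
    A ` H \<subseteq> K \<and>
    (\<forall>x\<in>H. \<forall>y\<in>H. A (x + y) = A x + A y) \<and>
    (\<forall>c. \<forall>x\<in>H. A (c *\<^sub>C x) = c *\<^sub>C A x) \<and>
    (\<exists>B. \<forall>x\<in>H. norm (A x) \<le> B * norm x)"

definition unitarily_equivalent ::
    "('a::complex_inner \<Rightarrow> 'a) \<Rightarrow> ('b::complex_inner \<Rightarrow> 'b) \<Rightarrow> bool"
  where "unitarily_equivalent T T' \<longleftrightarrow>
    (\<exists>U. bounded_op UNIV UNIV U \<and> surj U \<and> (\<forall>x y. cinner (U x) (U y) = cinner x y) \<and>
         (\<forall>x. U (T x) = T' (U x)))"

definition orthogonal_direct_sum :: "nat \<Rightarrow> (nat \<Rightarrow> 'a::complex_inner set) \<Rightarrow> bool"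
  where "orthogonal_direct_sum n H \<longleftrightarrow>
    (\<forall>i<n. csubspace (H i) \<and> closed (H i)) \<and>
    (\<forall>i<n. \<forall>j<n. i \<noteq> j \<longrightarrow> (\<forall>x\<in>H i. \<forall>y\<in>H j. cinner x y = 0)) \<and>
    (\<forall>x. \<exists>h. (\<forall>i<n. h i \<in> H i) \<and> x = (\<Sum>i<n. h i))"

text \<open>
  \<open>T\<close> is the bounded operator on the whole space with block matrix \<open>A\<close>,
  where \<open>A i j\<close> maps \<open>H j\<close> to \<open>H i\<close>.
\<close>

definition has_operator_matrix ::
    "nat \<Rightarrow> (nat \<Rightarrow> 'a::complex_inner set) \<Rightarrow> ('a \<Rightarrow> 'a) \<Rightarrow> (nat \<Rightarrow> nat \<Rightarrow> 'a \<Rightarrow> 'a) \<Rightarrow> bool"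
  where "has_operator_matrix n H T A \<longleftrightarrow>
    bounded_op UNIV UNIV T \<and> (\<forall>j<n. \<forall>x\<in>H j. T x = (\<Sum>i<n. A i j x))"

definition bidiagonal ::
    "(nat \<Rightarrow> 'a::complex_inner \<Rightarrow> 'a) \<Rightarrow> (nat \<Rightarrow> nat \<Rightarrow> 'a \<Rightarrow> 'a) \<Rightarrow> nat \<Rightarrow> nat \<Rightarrow> 'a \<Rightarrow> 'a"
  where "bidiagonal D S i j = (if j = i then D i else if j = Suc i then S i j else (\<lambda>_. 0))"

definition ker_shift :: "'a::complex_inner set \<Rightarrow> ('a \<Rightarrow> 'a) \<Rightarrow> complex \<Rightarrow> 'a set"
  where "ker_shift H A w = {x \<in> H. A x - w *\<^sub>C x = 0}"

text \<open>
  Since \<^const>\<open>cdim\<close> is \<open>0\<close> for infinite-dimensional spaces, the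
  condition \<open>1 \<le> n\<close> makes \<open>cdim V = n\<close> express finite dimension
  \<open>n\<close>.
\<close>

definition cowen_douglas ::
    "nat \<Rightarrow> complex set \<Rightarrow> 'a::separable_hilbert set \<Rightarrow> ('a \<Rightarrow> 'a) \<Rightarrow> bool"
  where "cowen_douglas n \<Omega> H A \<longleftrightarrow>
    1 \<le> n \<and> csubspace H \<and> closed H \<and> bounded_op H H A \<and>
    (\<forall>w\<in>\<Omega>. cdim (ker_shift H A w) = n \<and> (\<lambda>x. A x - w *\<^sub>C x) ` H = H) \<and>
    closure (cspan (\<Union>w\<in>\<Omega>. ker_shift H A w)) = H"

definition vholomorphic_on :: "(complex \<Rightarrow> 'a::complex_inner) \<Rightarrow> complex set \<Rightarrow> bool"
  where "vholomorphic_on s U \<longleftrightarrow> (\<forall>w\<in>U. \<exists>d. (s has_derivative (\<lambda>h. h *\<^sub>C d)) (at w within U))"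

text \<open>
  A bundle over \<open>U\<close> is given by its fibres \<open>E w\<close>, subspaces of the ambient
  Hilbert space; the bundle of an operator \<open>A\<close> on \<open>H\<close> is
  \<open>ker_shift H A\<close>.
\<close>

definition holomorphic_section ::
    "complex set \<Rightarrow> (complex \<Rightarrow> 'a::complex_inner set) \<Rightarrow> (complex \<Rightarrow> 'a) \<Rightarrow> bool"
  where "holomorphic_section U E s \<longleftrightarrow> vholomorphic_on s U \<and> (\<forall>w\<in>U. s w \<in> E w)"

definition bundle_sum ::
    "nat \<Rightarrow> (nat \<Rightarrow> complex \<Rightarrow> 'a::complex_inner set) \<Rightarrow> complex \<Rightarrow> 'a set"
  where "bundle_sum n E w = {\<Sum>i<n. x i | x. \<forall>i<n. x i \<in> E i w}"

definition orthogonal_holomorphic_frame ::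
    "nat \<Rightarrow> complex set \<Rightarrow> (complex \<Rightarrow> 'a::complex_inner set) \<Rightarrow> (nat \<Rightarrow> complex \<Rightarrow> 'a) \<Rightarrow> bool"
  where "orthogonal_holomorphic_frame n U E t \<longleftrightarrow>
    (\<forall>i<n. holomorphic_section U E (t i)) \<and>
    (\<forall>w\<in>U. inj_on (\<lambda>i. t i w) {..<n} \<and>
            \<not> cdependent ((\<lambda>i. t i w) ` {..<n}) \<and>
            cspan ((\<lambda>i. t i w) ` {..<n}) = E w \<and>
            (\<forall>i<n. \<forall>j<n. i \<noteq> j \<longrightarrow> cinner (t i w) (t j w) = 0))"

definition d_x :: "(complex \<Rightarrow> complex) \<Rightarrow> complex \<Rightarrow> complex"
  where "d_x f z = vector_derivative (\<lambda>r. f (z + complex_of_real r)) (at 0)"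

definition d_y :: "(complex \<Rightarrow> complex) \<Rightarrow> complex \<Rightarrow> complex"
  where "d_y f z = vector_derivative (\<lambda>r. f (z + \<i> * complex_of_real r)) (at 0)"

definition d_z :: "(complex \<Rightarrow> complex) \<Rightarrow> complex \<Rightarrow> complex"
  where "d_z f z = (d_x f z - \<i> * d_y f z) / 2"

definition d_zbar :: "(complex \<Rightarrow> complex) \<Rightarrow> complex \<Rightarrow> complex"
  where "d_zbar f z = (d_x f z + \<i> * d_y f z) / 2"

definition section_curvature :: "(complex \<Rightarrow> 'a::complex_inner) \<Rightarrow> complex \<Rightarrow> complex"
  where "section_curvature \<gamma> z =
    - d_z (d_zbar (\<lambda>w. complex_of_real (ln ((norm (\<gamma> w))\<^sup>2)))) z"

text \<open>
  The common value at \<open>z\<close> of the curvatures of all nowhere vanishing holomorphic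
  sections of the line bundle near \<open>z\<close>.
\<close>

definition curvature ::
    "complex set \<Rightarrow> 'a::complex_inner set \<Rightarrow> ('a \<Rightarrow> 'a) \<Rightarrow> complex \<Rightarrow> complex"
  where "curvature \<Omega> H A z =
    (THE k. \<exists>U \<gamma>. open U \<and> z \<in> U \<and> U \<subseteq> \<Omega> \<and>
       holomorphic_section U (ker_shift H A) \<gamma> \<and> (\<forall>w\<in>U. \<gamma> w \<noteq> 0) \<and>
       k = section_curvature \<gamma> z)"

definition flag_operator ::
    "nat \<Rightarrow> complex set \<Rightarrow> (nat \<Rightarrow> 'a::separable_hilbert set) \<Rightarrow> (nat \<Rightarrow> 'a \<Rightarrow> 'a) \<Rightarrow>
     (nat \<Rightarrow> nat \<Rightarrow> 'a \<Rightarrow> 'a) \<Rightarrow> ('a \<Rightarrow> 'a) \<Rightarrow> bool"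
  where "flag_operator n \<Omega> H D S T \<longleftrightarrow>
    orthogonal_direct_sum n H \<and>
    has_operator_matrix n H T (bidiagonal D S) \<and>
    (\<forall>i<n. cowen_douglas 1 \<Omega> (H i) (D i)) \<and>
    (\<forall>i\<in>{1..n - 1}.
       bounded_op (H i) (H (i - 1)) (S (i - 1) i) \<and>
       (\<exists>x\<in>H i. S (i - 1) i x \<noteq> 0) \<and>
       (\<forall>x\<in>H i. D (i - 1) (S (i - 1) i x) = S (i - 1) i (D i x)))"

definition flag_frame ::
    "nat \<Rightarrow> complex set \<Rightarrow> (nat \<Rightarrow> 'a::complex_inner set) \<Rightarrow> (nat \<Rightarrow> 'a \<Rightarrow> 'a) \<Rightarrow>
     (nat \<Rightarrow> nat \<Rightarrow> 'a \<Rightarrow> 'a) \<Rightarrow> (nat \<Rightarrow> complex \<Rightarrow> 'a) \<Rightarrow> bool"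
  where "flag_frame n \<Omega> H D S t \<longleftrightarrow>
    orthogonal_holomorphic_frame n \<Omega> (bundle_sum n (\<lambda>i. ker_shift (H i) (D i))) t \<and>
    (\<forall>i<n. holomorphic_section \<Omega> (ker_shift (H i) (D i)) (t i) \<and> (\<forall>w\<in>\<Omega>. t i w \<noteq> 0)) \<and>
    (\<forall>i\<in>{1..n - 1}. \<forall>w\<in>\<Omega>. t (i - 1) w = S (i - 1) i (t i w))"

end

theory Submission
  imports Defs "HOL-Complex_Analysis.Conformal_Mappings"
begin

text \<open>
  If the invariants agree, then the logarithm of \<open>norm (t' 0 w) / norm (t 0 w)\<close> is harmonic, so on a
  disc this ratio is \<open>cmod (\<phi> w)\<close> with \<open>\<phi>\<close> holomorphic, and the ratio
  conditions carry this over to all \<open>t' i\<close>. By polarization \<open>\<phi> w *\<^sub>C t i w\<close>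
  and \<open>t' i w\<close> have the same Gram matrix; both families span dense subspaces, so they are exchanged by
  a unitary operator, which intertwines the operators because it does so on the frames.

  Conversely, let \<open>U\<close> be a unitary intertwiner and \<open>N\<close>, \<open>N'\<close> the operators
  that shift the frames (the superdiagonal parts). A Kleinecke-Shirokov argument shows that everything commuting
  with \<open>T\<close> is upper triangular. Applied to the nilpotent operator obtained by transporting
  \<open>N'\<close> with \<open>U\<close>, this gives that \<open>U\<close> and its inverse respect the flags, hence, being
  unitary, the summands.
\<close>

text \<open>A disc is used because \<open>\<phi>\<close> comes from a primitive and
  \<open>\<Omega>\<close> need not be simply connected. Nothing is lost: a vector orthogonal to the
  frame over the disc is orthogonal to it over all of \<open>\<Omega>\<close> by the identity
  theorem. One \<open>\<phi>\<close> must serve all indices, since the shift sends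
  \<open>\<phi> w *\<^sub>C t i w\<close> to \<open>\<phi> w *\<^sub>C t (i - 1) w\<close>; the
  quotients of norms provide exactly this.

  In the converse, the obstacle is that a unitary equivalence acts between two decompositions and
  lies in no commutant, so only transported operators can be fed into a commutant argument. For
  \<open>X\<close> commuting with \<open>T\<close>, the block equation reads
  \<open>D_i X_ij - X_ij D_j = X_{i,j-1} S - S X_{i+1,j}\<close>. On the lowest diagonal that is not
  yet known to vanish, the entries act on the frame as scalar functions, and one diagonal higher the
  equation exhibits differences of these functions as a commutator that commutes with
  \<open>D_i\<close>. Such a commutator is quasinilpotent, so the differences vanish; as there is no
  column to the left of column 0, all the functions are zero.\<close>

section \<open>Algebra and continuity of the complex inner product\<close>

lemma cinner_add_right: "cinner x (y + z) = cinner x y + cinner x z"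
  by (metis cinner_add_left cinner_commute complex_cnj_add)

lemma cinner_scaleC_right: "cinner x (c *\<^sub>C y) = cnj c * cinner x y"
  by (metis cinner_scaleC_left cinner_commute complex_cnj_mult)

lemma cinner_zero_left [simp]: "cinner 0 x = 0"
  using cinner_add_left[of 0 0 x] by simp

lemma cinner_zero_right [simp]: "cinner x 0 = 0"
  using cinner_add_right[of x 0 0] by simp

lemma cinner_diff_left: "cinner (x - y) z = cinner x z - cinner y z"
  using cinner_add_left[of "x - y" y z] by simp

lemma cinner_diff_right: "cinner x (y - z) = cinner x y - cinner x z"
  using cinner_add_right[of x "y - z" z] by simp

lemma cinner_sum_left: "cinner (sum f A) y = (\<Sum>i\<in>A. cinner (f i) y)"
  by (induction A rule: infinite_finite_induct) (auto simp: cinner_add_left)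

lemma cinner_self: "cinner x x = complex_of_real ((norm x)\<^sup>2)"
proof (rule complex_eqI)
  show "Re (cinner x x) = Re (complex_of_real ((norm x)\<^sup>2))"
    by (simp add: dot_square_norm flip: inner_eq_Re_cinner)
  have "Im (cinner x x) = - Im (cinner x x)"
    by (subst cinner_commute) simp
  then show "Im (cinner x x) = Im (complex_of_real ((norm x)\<^sup>2))" by simp
qed

lemma cinner_self_eq_0_iff [simp]: "cinner x x = 0 \<longleftrightarrow> x = 0"
  by (simp add: cinner_self)

lemma norm_scaleC: "norm (c *\<^sub>C x) = cmod c * norm (x :: 'a :: complex_inner)"
proof -
  have "complex_of_real ((norm (c *\<^sub>C x))\<^sup>2) = complex_of_real ((cmod c * norm x)\<^sup>2)"
    unfolding cinner_self[symmetric] cinner_scaleC_left cinner_scaleC_right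
    by (simp add: cinner_self complex_norm_square power_mult_distrib flip: mult.assoc of_real_power)
  then show ?thesis
    by (smt (verit) of_real_eq_iff mult_nonneg_nonneg norm_ge_zero power2_eq_iff_nonneg)
qed

lemma cinner_bound: "cmod (cinner x y) \<le> norm x * norm y"
proof (cases "cinner x y = 0")
  case False
  \<comment> \<open>Rotating \<open>x\<close> by the unimodular \<open>c\<close> makes the inner
    product real and nonnegative, so the real Cauchy-Schwarz inequality applies.\<close>
  define c where "c = cnj (sgn (cinner x y))"
  have [simp]: "cmod c = 1" using False by (simp add: c_def norm_sgn)
  have "c * cinner x y = complex_of_real (cmod (cinner x y))"
    using False by (simp add: c_def sgn_eq complex_norm_square[symmetric] mult.commute power2_eq_square)
  then have "cmod (cinner x y) = inner (c *\<^sub>C x) y"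
    by (simp add: inner_eq_Re_cinner cinner_scaleC_left)
  also have "\<dots> \<le> norm x * norm y"
    using norm_cauchy_schwarz[of "c *\<^sub>C x" y] by (simp add: norm_scaleC)
  finally show ?thesis .
qed simp

lemma cinner_scaleR_left: "cinner (r *\<^sub>R x) y = r *\<^sub>R cinner x y"
  by (simp add: scaleR_scaleC[of r x] cinner_scaleC_left scaleR_conv_of_real)

lemma cinner_scaleR_right: "cinner x (r *\<^sub>R y) = r *\<^sub>R cinner x y"
  by (simp add: scaleR_scaleC[of r y] cinner_scaleC_right scaleR_conv_of_real)

lemma bounded_bilinear_cinner:
  "bounded_bilinear (cinner :: 'a::complex_inner \<Rightarrow> 'a \<Rightarrow> complex)"
  by (rule bounded_bilinear.intro)
    (auto simp: cinner_add_left cinner_add_right cinner_scaleR_left cinner_scaleR_right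
       intro!: exI[of _ 1] cinner_bound)

lemma scaleC_zero_right [simp]: "c *\<^sub>C 0 = 0"
  by (rule complex_vector.scale_zero_right)

lemma scaleC_zero_left [simp]: "0 *\<^sub>C x = 0"
  by (rule complex_vector.scale_zero_left)

lemma bounded_bilinear_scaleC:
  "bounded_bilinear (scaleC :: complex \<Rightarrow> 'a \<Rightarrow> 'a::complex_inner)"
  by (rule bounded_bilinear.intro)
    (auto simp: scaleC_add_left scaleC_add_right scaleR_scaleC[where 'a='a] scaleC_scaleC
       scaleR_conv_of_real norm_scaleC mult.commute intro!: exI[of _ 1])

lemmas scaleC_diff_right = complex_vector.scale_right_diff_distrib
lemmas scaleC_diff_left = complex_vector.scale_left_diff_distrib

lemmas tendsto_scaleC = bounded_bilinear.tendsto[OF bounded_bilinear_scaleC]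
lemmas tendsto_cinner = bounded_bilinear.tendsto[OF bounded_bilinear_cinner]

subsection \<open>Bounded complex linear operators\<close>

abbreviation cblinear :: "('a::complex_inner \<Rightarrow> 'b::complex_inner) \<Rightarrow> bool"
  where "cblinear \<equiv> bounded_op UNIV UNIV"

lemma cblinear_bounded_linear: "cblinear f \<Longrightarrow> bounded_linear f"
proof -
  assume f: "cblinear f"
  then obtain K where K: "\<And>x. norm (f x) \<le> K * norm x"
    unfolding bounded_op_def by blast
  show "bounded_linear f"
    by (rule bounded_linear_intro[of _ K])
      (use f K in \<open>auto simp: bounded_op_def scaleR_scaleC mult.commute\<close>)
qed

lemma cblinear_add: "cblinear f \<Longrightarrow> f (x + y) = f x + f y"
  and cblinear_scaleC: "cblinear f \<Longrightarrow> f (c *\<^sub>C x) = c *\<^sub>C f x"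
  unfolding bounded_op_def by auto

lemma cblinear_zero: "cblinear f \<Longrightarrow> f 0 = 0"
  using cblinear_scaleC[of f 0 0] by simp

lemma cblinear_diff: "cblinear f \<Longrightarrow> f (x - y) = f x - f y"
  by (simp add: cblinear_bounded_linear bounded_linear.linear linear_diff)

lemma cblinear_sum: "cblinear f \<Longrightarrow> f (sum g A) = (\<Sum>i\<in>A. f (g i))"
  by (simp add: cblinear_bounded_linear bounded_linear.linear linear_sum)

lemma cblinear_bound:
  assumes "cblinear f" obtains K where "K > 0" "\<And>x. norm (f x) \<le> K * norm x"
  using bounded_linear.pos_bounded[OF cblinear_bounded_linear[OF assms]] by (metis mult.commute)

lemma cblinearI:
  assumes "\<And>x y. f (x + y) = f x + f y" "\<And>c x. f (c *\<^sub>C x) = c *\<^sub>C f x"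
    and "\<And>x. norm (f x) \<le> K * norm x"
  shows "cblinear f"
  unfolding bounded_op_def using assms by auto

lemma cblinear_compose:
  assumes "cblinear f" "cblinear g" shows "cblinear (\<lambda>x. f (g x))"
proof -
  obtain K where K: "K > 0" "\<And>x. norm (f x) \<le> K * norm x" using cblinear_bound[OF assms(1)] by blast
  obtain L where L: "L > 0" "\<And>x. norm (g x) \<le> L * norm x" using cblinear_bound[OF assms(2)] by blast
  have "norm (f (g x)) \<le> (K * L) * norm x" for x
    using order_trans[OF K(2)[of "g x"] mult_left_mono[OF L(2)[of x], of K]] K(1) by (simp add: mult.assoc)
  then show ?thesis
    by (intro cblinearI)
      (auto simp: cblinear_add[OF assms(1)] cblinear_add[OF assms(2)] cblinear_scaleC[OF assms(1)]
        cblinear_scaleC[OF assms(2)])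
qed

lemma cblinear_plus:
  assumes "cblinear f" "cblinear g" shows "cblinear (\<lambda>x. f x + g x)"
proof -
  obtain K where K: "\<And>x. norm (f x) \<le> K * norm x" using cblinear_bound[OF assms(1)] by blast
  obtain L where L: "\<And>x. norm (g x) \<le> L * norm x" using cblinear_bound[OF assms(2)] by blast
  show ?thesis
  proof (rule cblinearI)
    show "norm (f x + g x) \<le> (K + L) * norm x" for x
      using norm_triangle_ineq[of "f x" "g x"] K[of x] L[of x] by (simp add: distrib_right)
    show "f (x + y) + g (x + y) = f x + g x + (f y + g y)" for x y
      using cblinear_add[OF assms(1), of x y] cblinear_add[OF assms(2), of x y] by simp
    show "f (c *\<^sub>C x) + g (c *\<^sub>C x) = c *\<^sub>C (f x + g x)" for c x
      using cblinear_scaleC[OF assms(1), of c x] cblinear_scaleC[OF assms(2), of c x]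
      by (simp add: scaleC_add_right)
  qed
qed

lemma cblinear_const_scaleC: "cblinear (\<lambda>x. c *\<^sub>C x)"
  by (rule cblinearI[of _ "cmod c"]) (auto simp: scaleC_add_right scaleC_scaleC mult.commute norm_scaleC)

lemma cblinear_id: "cblinear (\<lambda>x. x)"
  by (rule cblinearI[of _ 1]) auto

lemma cblinear_const_0: "cblinear (\<lambda>x. 0)"
  by (rule cblinearI[of _ 0]) auto

lemma cblinear_sub:
  assumes "cblinear f" "cblinear g" shows "cblinear (\<lambda>x. f x - g x)"
proof -
  have "f x - g x = f x + (-1) *\<^sub>C g x" for x
    by (simp add: complex_vector.scale_minus_left scaleC_one)
  then show ?thesis
    using cblinear_plus[OF assms(1) cblinear_compose[OF cblinear_const_scaleC assms(2)], of "-1"] by simp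
qed

lemma cblinear_setsum:
  "(\<And>i. i \<in> I \<Longrightarrow> cblinear (f i)) \<Longrightarrow> cblinear (\<lambda>x. \<Sum>i\<in>I. f i x)"
proof (induction I rule: infinite_finite_induct)
  case (insert i I)
  then show ?case
    using cblinear_plus[of "f i" "\<lambda>x. \<Sum>i\<in>I. f i x"] by simp
qed (simp_all add: cblinear_const_0)

lemma cblinear_funpow: "cblinear (f :: 'a::complex_inner \<Rightarrow> 'a) \<Longrightarrow> cblinear (f ^^ k)"
proof (induction k)
  case (Suc k)
  then show ?case
    using cblinear_compose[of f "f ^^ k"] by (simp add: comp_def)
qed (simp add: cblinear_id id_def)

text \<open>Blocks such as \<open>D i\<close> and \<open>S i (Suc i)\<close> are controlled only on
  a summand; precomposing with a projection makes total operators of them.\<close>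

lemma bounded_op_compose_cblinear:
  assumes "bounded_op H K f" "cblinear g" "\<And>x. g x \<in> H"
  shows "cblinear (\<lambda>x. f (g x))"
proof -
  obtain B where B: "\<And>x. x \<in> H \<Longrightarrow> norm (f x) \<le> B * norm x"
    using assms(1) unfolding bounded_op_def by blast
  obtain L where L: "L > 0" "\<And>x. norm (g x) \<le> L * norm x" using cblinear_bound[OF assms(2)] by blast
  \<comment> \<open>The bound \<open>B\<close> may be negative when \<open>H\<close> is trivial,
    hence the absolute value.\<close>
  have "norm (f (g x)) \<le> (\<bar>B\<bar> * L) * norm x" for x
  proof -
    have "norm (f (g x)) \<le> B * norm (g x)" by (rule B[OF assms(3)])
    also have "\<dots> \<le> \<bar>B\<bar> * norm (g x)" by (intro mult_right_mono) auto
    also have "\<dots> \<le> \<bar>B\<bar> * (L * norm x)" by (intro mult_left_mono L) auto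
    finally show ?thesis by (simp add: mult.assoc)
  qed
  then show ?thesis
    by (intro cblinearI)
      (use assms(1,3) in \<open>auto simp: cblinear_add[OF assms(2)] cblinear_scaleC[OF assms(2)] bounded_op_def\<close>)
qed

text \<open>The set where two bounded operators agree is a closed subspace; this reduces operator
  identities to frame vectors.\<close>

lemma cblinear_eq_on_closure_cspan:
  assumes f: "cblinear f" and g: "cblinear g"
    and eq: "\<And>v. v \<in> V \<Longrightarrow> f v = g v" and x: "x \<in> closure (cspan V)"
  shows "f x = g x"
proof -
  let ?E = "{x. f x = g x}"
  have "csubspace ?E"
    unfolding complex_vector.subspace_def
    by (auto simp: cblinear_zero[OF f] cblinear_zero[OF g] cblinear_add[OF f] cblinear_add[OF g]
        cblinear_scaleC[OF f] cblinear_scaleC[OF g])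
  then have "cspan V \<subseteq> ?E"
    using eq by (intro complex_vector.span_minimal) auto
  moreover have "closed ?E"
    by (intro closed_Collect_eq linear_continuous_on cblinear_bounded_linear f g)
  ultimately have "closure (cspan V) \<subseteq> ?E" by (rule closure_minimal)
  then show ?thesis using x by auto
qed

lemma closed_orthogonal: "closed {y. cinner y x = 0}"
  by (intro closed_Collect_eq continuous_intros
      linear_continuous_on bounded_bilinear.bounded_linear_left[OF bounded_bilinear_cinner])

lemma csubspace_orthogonal: "csubspace {y. cinner y x = 0}"
  unfolding complex_vector.subspace_def by (auto simp: cinner_add_left cinner_scaleC_left)

lemma orthogonal_closure_cspan:
  assumes "\<And>v. v \<in> V \<Longrightarrow> cinner v x = 0" and "y \<in> closure (cspan V)"
  shows "cinner y x = 0"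
proof -
  have "closure (cspan V) \<subseteq> {y. cinner y x = 0}"
    using assms(1)
    by (intro closure_minimal complex_vector.span_minimal csubspace_orthogonal closed_orthogonal) auto
  then show ?thesis using assms(2) by auto
qed

lemma csubspace_closure:
  assumes "csubspace (M :: 'a::complex_inner set)" shows "csubspace (closure M)"
  unfolding complex_vector.subspace_def
proof (intro conjI ballI allI)
  show "0 \<in> closure M"
    using assms closure_subset complex_vector.subspace_0 by blast
  show "x + y \<in> closure M" if xy: "x \<in> closure M" "y \<in> closure M" for x y
  proof -
    obtain f g where "\<And>n. f n \<in> M" "f \<longlonglongrightarrow> x" "\<And>n. g n \<in> M" "g \<longlonglongrightarrow> y"
      using xy unfolding closure_sequential by blast
    then show ?thesis
      unfolding closure_sequential
      by (intro exI[of _ "\<lambda>n. f n + g n"])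
         (auto intro: tendsto_intros complex_vector.subspace_add[OF assms])
  qed
  show "c *\<^sub>C x \<in> closure M" if x: "x \<in> closure M" for x c
  proof -
    obtain f where "\<And>n. f n \<in> M" "f \<longlonglongrightarrow> x"
      using x unfolding closure_sequential by blast
    then show ?thesis
      unfolding closure_sequential
      by (intro exI[of _ "\<lambda>n. c *\<^sub>C f n"])
         (auto intro: tendsto_scaleC complex_vector.subspace_scale[OF assms])
  qed
qed

lemma one_dimensional_span:
  assumes "csubspace V" "cdim V = 1" "v \<in> V" "v \<noteq> 0" "x \<in> V"
  shows "\<exists>c. x = c *\<^sub>C v"
proof -
  obtain B where B: "B \<subseteq> V" "V \<subseteq> cspan B" "card B = 1"
    using complex_vector.basis_exists[of V] assms(2) by metis
  then obtain b where "B = {b}" by (auto simp: card_1_singleton_iff)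
  with B have "V \<subseteq> range (\<lambda>k. k *\<^sub>C b)"
    by (simp add: complex_vector.span_singleton)
  with assms(3,5) obtain c d where cd: "v = c *\<^sub>C b" "x = d *\<^sub>C b"
    by blast
  with assms(4) have "c \<noteq> 0" by auto
  then have "x = (d / c) *\<^sub>C v" by (simp add: cd scaleC_scaleC)
  then show ?thesis by blast
qed

subsection \<open>Vector-valued holomorphic functions\<close>

definition vderiv :: "(complex \<Rightarrow> 'a::complex_inner) \<Rightarrow> complex \<Rightarrow> 'a"
  where "vderiv s w = (SOME d. (s has_derivative (\<lambda>h. h *\<^sub>C d)) (at w))"

lemma vholomorphic_has_derivative:
  assumes "vholomorphic_on s U" "open U" "w \<in> U"
  shows "(s has_derivative (\<lambda>h. h *\<^sub>C vderiv s w)) (at w)"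
proof -
  have "\<exists>d. (s has_derivative (\<lambda>h. h *\<^sub>C d)) (at w)"
    using assms at_within_open[of w U] unfolding vholomorphic_on_def by metis
  then show ?thesis unfolding vderiv_def by (rule someI_ex)
qed

lemma vholomorphic_onI:
  assumes "\<And>w. w \<in> U \<Longrightarrow> (s has_derivative (\<lambda>h. h *\<^sub>C d w)) (at w)"
  shows "vholomorphic_on s U"
  unfolding vholomorphic_on_def using assms has_derivative_at_withinI by blast

lemma vholomorphic_on_subset:
  "vholomorphic_on s U \<Longrightarrow> V \<subseteq> U \<Longrightarrow> vholomorphic_on s V"
  unfolding vholomorphic_on_def by (meson has_derivative_subset subsetD)

lemma cinner_has_field_derivative:
  assumes "(s has_derivative (\<lambda>h. h *\<^sub>C d)) (at w)"
  shows "((\<lambda>w. cinner (s w) x) has_field_derivative cinner d x) (at w)"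
  using bounded_linear.has_derivative
    [OF bounded_bilinear.bounded_linear_left[OF bounded_bilinear_cinner] assms, of x]
  unfolding has_field_derivative_def cinner_scaleC_left by (simp add: mult.commute[of _ "cinner d x"])

lemma cinner_vholomorphic:
  assumes "vholomorphic_on s U" "open U"
  shows "(\<lambda>w. cinner (s w) x) holomorphic_on U"
  using assms cinner_has_field_derivative[OF vholomorphic_has_derivative[OF assms]]
  by (auto simp: holomorphic_on_open)

lemma deriv_cinner:
  assumes "vholomorphic_on s U" "open U" "w \<in> U"
  shows "deriv (\<lambda>w. cinner (s w) x) w = cinner (vderiv s w) x"
  by (rule DERIV_imp_deriv cinner_has_field_derivative vholomorphic_has_derivative assms)+

text \<open>The constant depends on \<open>f\<close> only through \<open>M\<close>. This uniformity
  matters in \<open>vholomorphic_vderiv\<close>, where \<open>f\<close> runs through all functions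
  \<open>cinner (s w) x\<close>.\<close>

lemma deriv_remainder_bound:
  assumes f: "f holomorphic_on ball z (3 * r)" and r: "0 < r"
    and M: "\<And>w. w \<in> ball z (3 * r) \<Longrightarrow> cmod (f w) < M" and h: "cmod h < r"
  shows "cmod (deriv f (z + h) - deriv f z - h * deriv (deriv f) z) \<le> 6 * M / r ^ 3 * (cmod h)\<^sup>2"
proof -
  define F where "F i = (deriv ^^ Suc i) f" for i
  have der: "(F i has_field_derivative F (Suc i) x) (at x within ball z r)" if "x \<in> ball z r" for i x
  proof -
    have "F i holomorphic_on ball z (3 * r)"
      unfolding F_def by (intro holomorphic_higher_deriv f) auto
    moreover have "x \<in> ball z (3 * r)" using that r by auto
    ultimately have "(F i has_field_derivative deriv (F i) x) (at x)"
      by (intro holomorphic_derivI) auto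
    then show ?thesis by (simp add: F_def has_field_derivative_at_within)
  qed
  have bd: "cmod (F (Suc 1) x) \<le> 6 * M / r ^ 3" if "x \<in> ball z r" for x
  proof -
    \<comment> \<open>Closed discs of radius \<open>r\<close> around points of
      \<open>ball z r\<close> stay in the domain, so Cauchy's estimate bounds the third derivative;
      the 6 is \<open>fact 3\<close>.\<close>
    have sub: "cball x r \<subseteq> ball z (3 * r)"
      using that r by (simp add: cball_subset_ball_iff dist_commute)
    have "cmod ((deriv ^^ 3) f x) \<le> fact 3 * M / r ^ 3"
    proof (rule Cauchy_higher_deriv_bound)
      show "f holomorphic_on ball x r"
        by (rule holomorphic_on_subset[OF f]) (use sub ball_subset_cball in blast)
      show "continuous_on (cball x r) f"
        by (rule holomorphic_on_imp_continuous_on[OF holomorphic_on_subset[OF f sub]])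
      show "f w \<in> ball 0 M" if "w \<in> ball x r" for w
      proof -
        have "w \<in> ball z (3 * r)" using that sub ball_subset_cball by blast
        from M[OF this] show ?thesis by simp
      qed
    qed (use r in auto)
    then show ?thesis by (simp add: F_def numeral_3_eq_3 fact_numeral)
  qed
  \<comment> \<open>First-order Taylor formula for \<open>F 0\<close>, the derivative of
    \<open>f\<close>, whose second derivative is the third derivative of \<open>f\<close>.\<close>
  have "cmod (F 0 (z + h) - (\<Sum>i\<le>1. F i z * (z + h - z) ^ i / fact i))
      \<le> 6 * M / r ^ 3 * cmod (z + h - z) ^ Suc 1 / fact 1"
    by (rule complex_Taylor[OF convex_ball[of z r] der bd]) (use h r in \<open>auto simp: dist_norm\<close>)
  then show ?thesis
    by (simp add: F_def power2_eq_square diff_diff_eq mult.commute)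
qed

text \<open>From weak to strong differentiability: paired with any \<open>x\<close>, the difference
  quotients \<open>q h\<close> converge with error at most \<open>C * norm x * cmod h\<close>. As
  \<open>C\<close> does not depend on \<open>x\<close>, the quotients are Cauchy in norm.\<close>

lemma vholomorphic_vderiv:
  fixes s :: "complex \<Rightarrow> 'a::separable_hilbert"
  assumes s: "vholomorphic_on s U" and U: "open U"
  shows "vholomorphic_on (vderiv s) U"
proof -
  have "\<exists>e. (vderiv s has_derivative (\<lambda>h. h *\<^sub>C e)) (at z)" if z: "z \<in> U" for z
  proof -
    define M where "M = norm (s z) + 1"
    have "isCont s z"
      using has_derivative_continuous[OF vholomorphic_has_derivative[OF s U z]] by simp
    then have "isCont (\<lambda>w. norm (s w)) z" by (intro continuous_intros)
    then have "((\<lambda>w. norm (s w)) \<longlongrightarrow> norm (s z)) (nhds z)"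
      using tendsto_at_iff_tendsto_nhds[of "\<lambda>w. norm (s w)" z] by (simp add: isCont_def)
    then have "\<forall>\<^sub>F w in nhds z. norm (s w) < M"
      by (rule order_tendstoD) (simp add: M_def)
    moreover have "\<forall>\<^sub>F w in nhds z. w \<in> U" using U z by (rule eventually_nhds_in_open)
    ultimately have "\<forall>\<^sub>F w in nhds z. norm (s w) < M \<and> w \<in> U" by eventually_elim auto
    then obtain R where R: "R > 0" "\<And>w. dist w z < R \<Longrightarrow> norm (s w) < M \<and> w \<in> U"
      unfolding eventually_nhds_metric by blast
    define r where "r = R / 3"
    have r: "r > 0" using R by (simp add: r_def)
    have ball: "norm (s w) < M" "w \<in> U" if "w \<in> ball z (3 * r)" for w
      using R(2)[of w] that by (auto simp: r_def dist_commute)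
    have Mpos: "M > 0" by (simp add: M_def add_nonneg_pos)
    define C where "C = 6 * M / r ^ 3"
    have C: "C > 0" using Mpos r by (simp add: C_def)
    define q where "q h = inverse h *\<^sub>C (vderiv s (z + h) - vderiv s z)" for h
    have weak: "\<exists>c. \<forall>h. h \<noteq> 0 \<and> cmod h < r \<longrightarrow> cmod (cinner (q h) x - c) \<le> C * norm x * cmod h"
      if x: "x \<noteq> 0" for x
    proof (intro exI allI impI)
      let ?f = "\<lambda>w. cinner (s w) x"
      fix h assume h: "h \<noteq> 0 \<and> cmod h < r"
      have hol: "?f holomorphic_on ball z (3 * r)"
        by (rule holomorphic_on_subset[OF cinner_vholomorphic[OF s U]]) (use ball in auto)
      have "cmod (?f w) < M * norm x" if "w \<in> ball z (3 * r)" for w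
        by (rule le_less_trans[OF cinner_bound mult_strict_right_mono[OF ball(1)[OF that]]]) (use x in simp)
      then have "cmod (deriv ?f (z + h) - deriv ?f z - h * deriv (deriv ?f) z)
          \<le> 6 * (M * norm x) / r ^ 3 * (cmod h)\<^sup>2"
        by (intro deriv_remainder_bound hol r) (use h in auto)
      moreover have "z + h \<in> U" using ball(2)[of "z + h"] h r by (simp add: dist_norm)
      ultimately have *: "cmod (cinner (vderiv s (z + h) - vderiv s z) x - h * deriv (deriv ?f) z)
          \<le> C * norm x * (cmod h)\<^sup>2"
        by (simp add: deriv_cinner[OF s U] z cinner_diff_left C_def mult_ac)
      have "cinner (q h) x - deriv (deriv ?f) z
          = inverse h * (cinner (vderiv s (z + h) - vderiv s z) x - h * deriv (deriv ?f) z)"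
        using h by (simp add: q_def cinner_scaleC_left right_diff_distrib)
      then have "cmod (cinner (q h) x - deriv (deriv ?f) z)
          \<le> inverse (cmod h) * (C * norm x * (cmod h)\<^sup>2)"
        using mult_left_mono[OF *, of "inverse (cmod h)"] by (simp add: norm_mult norm_inverse)
      then show "cmod (cinner (q h) x - deriv (deriv ?f) z) \<le> C * norm x * cmod h"
        using h by (simp add: power2_eq_square field_simps)
    qed
    have strong: "norm (q h - q k) \<le> C * (cmod h + cmod k)"
      if "h \<noteq> 0" "cmod h < r" "k \<noteq> 0" "cmod k < r" for h k
    proof (cases "q h = q k")
      case True
      then show ?thesis using C by simp
    next
      case False
      \<comment> \<open>Testing against the difference itself turns the weak estimate into a norm
        estimate; the unknown weak limit \<open>c\<close> cancels.\<close>
      define x where "x = q h - q k"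
      from False have x: "x \<noteq> 0" by (simp add: x_def)
      from weak[OF x] obtain c where c: "\<And>h. h \<noteq> 0 \<Longrightarrow> cmod h < r \<Longrightarrow>
          cmod (cinner (q h) x - c) \<le> C * norm x * cmod h" by blast
      have "(norm x)\<^sup>2 = cmod (cinner x x)" by (simp only: cinner_self) (simp add: norm_power)
      also have "cinner x x = (cinner (q h) x - c) - (cinner (q k) x - c)"
        by (simp add: x_def cinner_diff_left)
      also have "cmod \<dots> \<le> C * norm x * cmod h + C * norm x * cmod k"
        using norm_triangle_ineq4[of "cinner (q h) x - c" "cinner (q k) x - c"]
          c[OF that(1,2)] c[OF that(3,4)] by linarith
      finally have "norm x * norm x \<le> norm x * (C * (cmod h + cmod k))"
        by (simp add: power2_eq_square algebra_simps)
      then have "norm x \<le> C * (cmod h + cmod k)" using x by simp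
      then show ?thesis by (simp add: x_def)
    qed
    \<comment> \<open>A null sequence whose terms are all nonzero and, thanks to the 2, strictly
      inside the disc of radius \<open>r\<close>.\<close>
    define hs where "hs n = complex_of_real (r / (real n + 2))" for n :: nat
    have hs: "hs n \<noteq> 0" "cmod (hs n) < r" "cmod (hs n) = r / (real n + 2)" for n
    proof -
      show eq: "cmod (hs n) = r / (real n + 2)" using r by (simp only: hs_def norm_of_real) simp
      then show "hs n \<noteq> 0" using r by (metis divide_pos_pos norm_zero less_irrefl of_nat_0_le_iff add_nonneg_pos zero_less_numeral)
      show "cmod (hs n) < r" unfolding eq using r by (simp add: divide_less_eq)
    qed
    have lim0: "(\<lambda>n. cmod (hs n)) \<longlonglongrightarrow> 0"
      unfolding hs(3) by real_asymp
    have "Cauchy (\<lambda>n. q (hs n))"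
    proof (rule metric_CauchyI)
      fix e :: real assume e: "e > 0"
      then have "\<forall>\<^sub>F n in sequentially. cmod (hs n) < e / (2 * C)"
        using C by (intro order_tendstoD(2)[OF lim0]) auto
      then obtain N where N: "\<And>n. n \<ge> N \<Longrightarrow> cmod (hs n) < e / (2 * C)"
        unfolding eventually_sequentially by blast
      have "dist (q (hs m)) (q (hs n)) < e" if "m \<ge> N" "n \<ge> N" for m n
      proof -
        have "norm (q (hs m) - q (hs n)) \<le> C * (cmod (hs m) + cmod (hs n))"
          by (intro strong hs)
        also have "\<dots> < C * (e / (2 * C) + e / (2 * C))"
          using C N[OF that(1)] N[OF that(2)] by (intro mult_strict_left_mono add_strict_mono)
        finally show ?thesis using C by (simp add: dist_norm)
      qed
      then show "\<exists>N. \<forall>m\<ge>N. \<forall>n\<ge>N. dist (q (hs m)) (q (hs n)) < e" by blast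
    qed
    then obtain e where e: "(\<lambda>n. q (hs n)) \<longlonglongrightarrow> e"
      using Cauchy_convergent convergent_def by blast
    have qe: "norm (q h - e) \<le> C * cmod h" if "h \<noteq> 0" "cmod h < r" for h
    proof (rule LIMSEQ_le)
      show "(\<lambda>n. norm (q h - q (hs n))) \<longlonglongrightarrow> norm (q h - e)" by (intro tendsto_intros e)
      show "(\<lambda>n. C * (cmod h + cmod (hs n))) \<longlonglongrightarrow> C * cmod h"
        using tendsto_mult_left[OF tendsto_add[OF tendsto_const lim0], of C "cmod h"] by simp
      show "\<exists>N. \<forall>n\<ge>N. norm (q h - q (hs n)) \<le> C * (cmod h + cmod (hs n))"
        using strong that hs by blast
    qed
    have rem: "norm (vderiv s (z + h) - vderiv s z - h *\<^sub>C e) / cmod h \<le> C * cmod h"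
      if "h \<noteq> 0" "cmod h < r" for h
    proof -
      have "vderiv s (z + h) - vderiv s z - h *\<^sub>C e = h *\<^sub>C (q h - e)"
        using that by (simp add: q_def scaleC_diff_right scaleC_scaleC scaleC_one)
      then show ?thesis using qe[OF that] that by (simp add: norm_scaleC)
    qed
    have "(\<lambda>h. norm (vderiv s (z + h) - vderiv s z - h *\<^sub>C e) / cmod h) \<midarrow>0\<rightarrow> 0"
    proof (rule Lim_null_comparison)
      show "\<forall>\<^sub>F h in at 0. norm (norm (vderiv s (z + h) - vderiv s z - h *\<^sub>C e) / cmod h) \<le> C * cmod h"
        unfolding eventually_at using r rem by (intro exI[of _ r]) auto
      show "((\<lambda>h. C * cmod h) \<longlongrightarrow> 0) (at (0 :: complex))"
        by (rule tendsto_eq_intros refl)+ auto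
    qed
    then show ?thesis
      unfolding has_derivative_at
      by (intro exI[of _ e] conjI bounded_bilinear.bounded_linear_left[OF bounded_bilinear_scaleC])
  qed
  then show ?thesis
    unfolding vholomorphic_on_def using has_derivative_at_withinI by blast
qed

lemma vholomorphic_funpow_vderiv:
  fixes s :: "complex \<Rightarrow> 'a::separable_hilbert"
  assumes "vholomorphic_on s U" "open U"
  shows "vholomorphic_on ((vderiv ^^ m) s) U"
  by (induction m) (auto intro: assms vholomorphic_vderiv)

lemma higher_deriv_cinner:
  fixes s :: "complex \<Rightarrow> 'a::separable_hilbert"
  assumes s: "vholomorphic_on s U" and U: "open U" and w: "w \<in> U"
  shows "(deriv ^^ m) (\<lambda>w. cinner (s w) x) w = cinner ((vderiv ^^ m) s w) x"
  using w
proof (induction m arbitrary: w)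
  case (Suc m)
  have "\<forall>\<^sub>F v in nhds w. (deriv ^^ m) (\<lambda>w. cinner (s w) x) v = cinner ((vderiv ^^ m) s v) x"
    using eventually_nhds_in_open[OF U Suc.prems] by eventually_elim (rule Suc.IH)
  then have "deriv ((deriv ^^ m) (\<lambda>w. cinner (s w) x)) w = deriv (\<lambda>v. cinner ((vderiv ^^ m) s v) x) w"
    by (intro deriv_cong_ev) auto
  also have "\<dots> = cinner (vderiv ((vderiv ^^ m) s) w) x"
    by (intro deriv_cinner[OF vholomorphic_funpow_vderiv[OF s U] U] Suc.prems)
  finally show ?case by simp
qed simp

lemma vholomorphic_scaleC:
  assumes f: "f holomorphic_on U" and s: "vholomorphic_on s U" and U: "open U"
  shows "vholomorphic_on (\<lambda>w. f w *\<^sub>C s w) U"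
proof (rule vholomorphic_onI)
  fix w assume w: "w \<in> U"
  have "(f has_field_derivative deriv f w) (at w)"
    using f U w by (rule holomorphic_derivI)
  from bounded_bilinear.FDERIV[OF bounded_bilinear_scaleC this[unfolded has_field_derivative_def]
      vholomorphic_has_derivative[OF s U w]]
  show "((\<lambda>w. f w *\<^sub>C s w) has_derivative (\<lambda>h. h *\<^sub>C (f w *\<^sub>C vderiv s w + deriv f w *\<^sub>C s w))) (at w)"
    by (simp add: scaleC_add_right scaleC_scaleC mult.commute)
qed

lemma vholomorphic_complex_iff:
  fixes f :: "complex \<Rightarrow> complex"
  shows "vholomorphic_on f U \<longleftrightarrow> f holomorphic_on U"
proof -
  have "(\<lambda>h. h *\<^sub>C d) = (*) d" for d :: complex by (auto simp: scaleC_complex_def mult.commute)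
  then show ?thesis
    by (simp add: vholomorphic_on_def holomorphic_on_def field_differentiable_def has_field_derivative_def)
qed

lemma cinner_eq_0_continuation:
  assumes s: "vholomorphic_on s \<Omega>" and \<Omega>: "open \<Omega>" "connected \<Omega>"
    and B: "open B" "B \<noteq> {}" "B \<subseteq> \<Omega>" "\<And>w. w \<in> B \<Longrightarrow> cinner (s w) x = 0" and w: "w \<in> \<Omega>"
  shows "cinner (s w) x = 0"
  by (rule analytic_continuation_open[OF B(1) \<Omega>(1) B(2) \<Omega>(2) B(3) cinner_vholomorphic[OF s \<Omega>(1)]
        holomorphic_on_const[of 0] B(4) w])

subsection \<open>Wirtinger derivatives and curvature\<close>

text \<open>Total differentiability with the two Wirtinger derivatives as coefficients. It obeys sum
  and quotient rules, which the mere existence of the partial derivatives in \<open>d_z\<close> and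
  \<open>d_zbar\<close> would not give.\<close>

definition has_wirtinger ::
    "(complex \<Rightarrow> complex) \<Rightarrow> complex \<Rightarrow> complex \<Rightarrow> complex \<Rightarrow> bool"
  where "has_wirtinger F a b z \<longleftrightarrow> (F has_derivative (\<lambda>h. a * h + b * cnj h)) (at z)"

lemma wirtinger_vector_derivative:
  assumes "has_wirtinger F a b z"
  shows "vector_derivative (\<lambda>r. F (z + v * complex_of_real r)) (at 0) = a * v + b * cnj v"
proof -
  have "((\<lambda>r. z + v * complex_of_real r) has_derivative (\<lambda>r. v * complex_of_real r)) (at 0)"
    by (auto intro!: derivative_eq_intros)
  moreover have "(F has_derivative (\<lambda>h. a * h + b * cnj h)) (at (z + v * complex_of_real 0))"
    using assms by (simp add: has_wirtinger_def)
  ultimately have "((\<lambda>r. F (z + v * complex_of_real r)) has_derivative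
      (\<lambda>r. a * (v * complex_of_real r) + b * cnj (v * complex_of_real r))) (at 0)"
    by (rule has_derivative_compose)
  then have "((\<lambda>r. F (z + v * complex_of_real r)) has_vector_derivative a * v + b * cnj v) (at 0)"
    by (simp add: has_vector_derivative_def scaleR_conv_of_real algebra_simps)
  then show ?thesis by (rule vector_derivative_at)
qed

lemma wirtinger_d_x: "has_wirtinger F a b z \<Longrightarrow> d_x F z = a + b"
  using wirtinger_vector_derivative[of F a b z 1] by (simp add: d_x_def)

lemma wirtinger_d_y: "has_wirtinger F a b z \<Longrightarrow> d_y F z = \<i> * a - \<i> * b"
  using wirtinger_vector_derivative[of F a b z \<i>] by (simp add: d_y_def)

lemma wirtinger_d_z: "has_wirtinger F a b z \<Longrightarrow> d_z F z = a"
  by (simp add: d_z_def wirtinger_d_x wirtinger_d_y algebra_simps flip: mult.assoc)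

lemma wirtinger_d_zbar: "has_wirtinger F a b z \<Longrightarrow> d_zbar F z = b"
  by (simp add: d_zbar_def wirtinger_d_x wirtinger_d_y algebra_simps flip: mult.assoc)

lemma wirtinger_unique:
  "has_wirtinger F a b z \<Longrightarrow> has_wirtinger F a' b' z \<Longrightarrow> a = a' \<and> b = b'"
  using wirtinger_d_z wirtinger_d_zbar by metis

lemma wirtinger_transform:
  assumes "has_wirtinger F a b z" "open U" "z \<in> U" "\<And>w. w \<in> U \<Longrightarrow> F w = G w"
  shows "has_wirtinger G a b z"
  using assms unfolding has_wirtinger_def by (rule has_derivative_transform_within_open)

lemma wirtinger_add:
  "has_wirtinger F a b z \<Longrightarrow> has_wirtinger G c d z \<Longrightarrow> has_wirtinger (\<lambda>w. F w + G w) (a + c) (b + d) z"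
  unfolding has_wirtinger_def by (drule (1) has_derivative_add) (simp add: algebra_simps)

lemma wirtinger_diff:
  "has_wirtinger F a b z \<Longrightarrow> has_wirtinger G c d z \<Longrightarrow> has_wirtinger (\<lambda>w. F w - G w) (a - c) (b - d) z"
  unfolding has_wirtinger_def by (drule (1) has_derivative_diff) (simp add: algebra_simps)

lemma wirtinger_cnj:
  "has_wirtinger F a b z \<Longrightarrow> has_wirtinger (\<lambda>w. cnj (F w)) (cnj b) (cnj a) z"
  unfolding has_wirtinger_def by (drule has_derivative_cnj) (simp add: algebra_simps)

lemma wirtinger_holomorphic_iff:
  "has_wirtinger F a 0 z \<longleftrightarrow> (F has_field_derivative a) (at z)"
  by (simp add: has_wirtinger_def has_field_derivative_def)

lemma wirtinger_divide:
  assumes "has_wirtinger F a b z" "has_wirtinger G c d z" "G z \<noteq> 0"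
  shows "has_wirtinger (\<lambda>w. F w / G w) ((a * G z - F z * c) / (G z * G z))
    ((b * G z - F z * d) / (G z * G z)) z"
  using has_derivative_divide'[OF assms(1,2)[unfolded has_wirtinger_def] assms(3)]
  unfolding has_wirtinger_def
  by (rule has_derivative_eq_rhs) (auto simp: algebra_simps add_divide_distrib diff_divide_distrib)

lemma wirtinger_cinner:
  assumes "(s has_derivative (\<lambda>h. h *\<^sub>C d)) (at z)" "(r has_derivative (\<lambda>h. h *\<^sub>C e)) (at z)"
  shows "has_wirtinger (\<lambda>w. cinner (s w) (r w)) (cinner d (r z)) (cinner (s z) e) z"
  using bounded_bilinear.FDERIV[OF bounded_bilinear_cinner assms]
  by (simp add: has_wirtinger_def cinner_scaleC_left cinner_scaleC_right algebra_simps)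

lemma wirtinger_ln_norm:
  assumes s: "(s has_derivative (\<lambda>h. h *\<^sub>C d)) (at z)" and nz: "s z \<noteq> 0"
  shows "has_wirtinger (\<lambda>w. complex_of_real (ln ((norm (s w))\<^sup>2)))
    (cinner d (s z) / cinner (s z) (s z)) (cinner (s z) d / cinner (s z) (s z)) z"
proof -
  have "((\<lambda>w. inner (s w) (s w)) has_derivative
      (\<lambda>h. inner (s z) (h *\<^sub>C d) + inner (h *\<^sub>C d) (s z))) (at z)"
    by (rule has_derivative_inner[OF s s])
  moreover have "0 < inner (s z) (s z)" using nz by simp
  ultimately have "((\<lambda>w. ln (inner (s w) (s w))) has_derivative
      (\<lambda>h. (inner (s z) (h *\<^sub>C d) + inner (h *\<^sub>C d) (s z)) * inverse (inner (s z) (s z)))) (at z)"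
    by (intro has_derivative_ln)
  then have "((\<lambda>w. complex_of_real (ln (inner (s w) (s w)))) has_derivative (\<lambda>h. complex_of_real
      ((inner (s z) (h *\<^sub>C d) + inner (h *\<^sub>C d) (s z)) * inverse (inner (s z) (s z))))) (at z)"
    by (rule has_derivative_of_real)
  moreover have "complex_of_real ((inner (s z) (h *\<^sub>C d) + inner (h *\<^sub>C d) (s z)) * inverse (inner (s z) (s z)))
    = cinner d (s z) / cinner (s z) (s z) * h + cinner (s z) d / cinner (s z) (s z) * cnj h" for h
  proof -
    \<comment> \<open>Twice the real part is a number plus its conjugate, which separates the part
      linear in \<open>h\<close> from the part linear in \<open>cnj h\<close>.\<close>
    have "complex_of_real (inner (s z) (h *\<^sub>C d) + inner (h *\<^sub>C d) (s z))
        = complex_of_real (2 * Re (cinner (h *\<^sub>C d) (s z)))"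
      by (simp add: inner_commute[of "s z"] flip: inner_eq_Re_cinner)
    also have "\<dots> = cinner (h *\<^sub>C d) (s z) + cnj (cinner (h *\<^sub>C d) (s z))"
      by (simp only: complex_add_cnj)
    also have "\<dots> = cinner d (s z) * h + cinner (s z) d * cnj h"
      using cinner_commute[of "s z" d] by (simp add: cinner_scaleC_left mult.commute)
    finally have "complex_of_real (inner (s z) (h *\<^sub>C d) + inner (h *\<^sub>C d) (s z))
      = cinner d (s z) * h + cinner (s z) d * cnj h" .
    moreover have "complex_of_real (inner (s z) (s z)) = cinner (s z) (s z)"
      by (simp add: cinner_self dot_square_norm)
    ultimately show ?thesis by (simp only: of_real_mult of_real_inverse) (simp add: field_simps add_divide_distrib)
  qed
  ultimately show ?thesis
    by (simp add: has_wirtinger_def power2_norm_eq_inner)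
qed

text \<open>The \<open>d_zbar\<close> derivative of the logarithm of the squared norm, that is, the
  conjugate of the Chern connection coefficient in the frame \<open>s\<close>. The curvature is
  minus its \<open>d_z\<close> derivative.\<close>

definition conn :: "(complex \<Rightarrow> 'a::complex_inner) \<Rightarrow> complex \<Rightarrow> complex"
  where "conn s w = cinner (s w) (vderiv s w) / cinner (s w) (s w)"

lemma wirtinger_ln_norm_conn:
  assumes "vholomorphic_on s U" "open U" "w \<in> U" "s w \<noteq> 0"
  shows "has_wirtinger (\<lambda>w. complex_of_real (ln ((norm (s w))\<^sup>2))) (cnj (conn s w)) (conn s w) w"
  using wirtinger_ln_norm[OF vholomorphic_has_derivative[OF assms(1-3)] assms(4)]
  by (simp add: conn_def flip: cinner_commute)

lemma wirtinger_conn: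
  fixes s :: "complex \<Rightarrow> 'a::separable_hilbert"
  assumes s: "vholomorphic_on s U" and U: "open U" and w: "w \<in> U" and nz: "s w \<noteq> 0"
  shows "\<exists>a b. has_wirtinger (conn s) a b w"
proof -
  note ds = vholomorphic_has_derivative[OF s U w]
    and dd = vholomorphic_has_derivative[OF vholomorphic_vderiv[OF s U] U w]
  show ?thesis
    using wirtinger_divide[OF wirtinger_cinner[OF ds dd] wirtinger_cinner[OF ds ds]] nz
    unfolding conn_def[abs_def] by auto
qed

lemma section_curvature_eq:
  assumes s: "vholomorphic_on s U" and U: "open U" and z: "z \<in> U"
    and nz: "\<And>w. w \<in> U \<Longrightarrow> s w \<noteq> 0" and a: "has_wirtinger (conn s) a b z"
  shows "section_curvature s z = - a"
proof -
  have "conn s w = d_zbar (\<lambda>w. complex_of_real (ln ((norm (s w))\<^sup>2))) w" if "w \<in> U" for w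
    using wirtinger_d_zbar[OF wirtinger_ln_norm_conn[OF s U that nz[OF that]]] by simp
  from wirtinger_transform[OF a U z this] show ?thesis
    by (simp add: section_curvature_def wirtinger_d_z)
qed

text \<open>The factor \<open>f\<close> relating the two sections is holomorphic, so it changes
  \<open>conn\<close> by the antiholomorphic term \<open>cnj (f' / f)\<close>, which
  \<open>d_z\<close> annihilates. This makes the curvature of a line bundle well defined.\<close>

lemma section_curvature_proportional:
  fixes s r :: "complex \<Rightarrow> 'a::separable_hilbert"
  assumes s: "vholomorphic_on s U" and r: "vholomorphic_on r U" and U: "open U" and z: "z \<in> U"
    and snz: "\<And>w. w \<in> U \<Longrightarrow> s w \<noteq> 0" and rnz: "\<And>w. w \<in> U \<Longrightarrow> r w \<noteq> 0"
    and proportional: "\<And>w. w \<in> U \<Longrightarrow> \<exists>c. r w = c *\<^sub>C s w"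
  shows "section_curvature r z = section_curvature s z"
proof -
  \<comment> \<open>Near \<open>z\<close> the pairing with the fixed vector \<open>s z\<close> does
    not vanish, so \<open>f\<close> can be written as a quotient of two holomorphic scalar
    functions.\<close>
  define V where "V = {w \<in> U. cinner (s w) (s z) \<noteq> 0}"
  have "V = U \<inter> (\<lambda>w. cinner (s w) (s z)) -` (- {0})" by (auto simp: V_def)
  then have V: "open V"
    using continuous_open_preimage[OF
        holomorphic_on_imp_continuous_on[OF cinner_vholomorphic[OF s U, of "s z"]] U, of "- {0}"]
    by (simp add: open_Compl)
  have zV: "z \<in> V" using z snz by (simp add: V_def)
  have VU: "V \<subseteq> U" by (auto simp: V_def)
  note sV = vholomorphic_on_subset[OF s VU] and rV = vholomorphic_on_subset[OF r VU]
  define f where "f w = cinner (r w) (s z) / cinner (s w) (s z)" for w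
  have f: "f holomorphic_on V"
    unfolding f_def by (intro holomorphic_intros cinner_vholomorphic sV rV V) (auto simp: V_def)
  \<comment> \<open>The function \<open>f\<close> is regarded as a section in the Hilbert space
    \<open>complex\<close>, so that \<open>conn\<close> and its rules apply to it as well.\<close>
  then have fv: "vholomorphic_on f V" by (simp add: vholomorphic_complex_iff)
  have rf: "r w = f w *\<^sub>C s w" if w: "w \<in> V" for w
  proof -
    obtain c where c: "r w = c *\<^sub>C s w" using proportional w VU by blast
    with w have "f w = c" by (simp add: f_def V_def cinner_scaleC_left)
    with c show ?thesis by simp
  qed
  have fnz: "f w \<noteq> 0" if "w \<in> V" for w
    using rf[OF that] rnz[of w] VU that by auto
  have conn: "conn f w + conn s w = conn r w" if w: "w \<in> V" for w
  proof -
    have "has_wirtinger (\<lambda>w. complex_of_real (ln ((norm (f w))\<^sup>2)) + complex_of_real (ln ((norm (s w))\<^sup>2)))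
        (cnj (conn f w) + cnj (conn s w)) (conn f w + conn s w) w"
      using w fnz snz VU by (intro wirtinger_add wirtinger_ln_norm_conn[OF _ V] fv sV) auto
    then have "has_wirtinger (\<lambda>w. complex_of_real (ln ((norm (r w))\<^sup>2)))
        (cnj (conn f w) + cnj (conn s w)) (conn f w + conn s w) w"
    proof (rule wirtinger_transform[OF _ V w])
      fix v assume "v \<in> V"
      then show "complex_of_real (ln ((norm (f v))\<^sup>2)) + complex_of_real (ln ((norm (s v))\<^sup>2))
          = complex_of_real (ln ((norm (r v))\<^sup>2))"
        using rf fnz snz VU by (auto simp: norm_scaleC power_mult_distrib ln_mult)
    qed
    moreover have "r w \<noteq> 0" using rnz w VU by auto
    then have "has_wirtinger (\<lambda>w. complex_of_real (ln ((norm (r w))\<^sup>2)))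
        (cnj (conn r w)) (conn r w) w"
      by (rule wirtinger_ln_norm_conn[OF rV V w])
    ultimately show ?thesis by (rule wirtinger_unique[THEN conjunct2])
  qed
  have "(\<lambda>w. vderiv f w / f w) holomorphic_on V"
    using vholomorphic_vderiv[OF fv V] fnz f
    by (intro holomorphic_intros) (auto simp: vholomorphic_complex_iff)
  then have "((\<lambda>w. vderiv f w / f w) has_field_derivative deriv (\<lambda>w. vderiv f w / f w) z) (at z)"
    using V zV by (rule holomorphic_derivI)
  from wirtinger_cnj[OF iffD2[OF wirtinger_holomorphic_iff this]]
  obtain d where "has_wirtinger (\<lambda>w. cnj (vderiv f w / f w)) 0 d z" by auto
  then have cf: "has_wirtinger (conn f) 0 d z"
    by (rule wirtinger_transform[OF _ V zV]) (use fnz in \<open>simp add: conn_def cinner_complex_def\<close>)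
  obtain a b where ab: "has_wirtinger (conn s) a b z"
    using wirtinger_conn[OF s U z snz[OF z]] by blast
  have "has_wirtinger (conn r) a (d + b) z"
    using wirtinger_transform[OF wirtinger_add[OF cf ab] V zV conn] by simp
  then show ?thesis
    using section_curvature_eq[OF s U z snz ab] section_curvature_eq[OF r U z rnz] by simp
qed

text \<open>
  The logarithm of the ratio of the two norms is harmonic, hence the real part of a holomorphic
  function on a convex domain.
\<close>

lemma equal_curvature_norm_ratio:
  fixes s :: "complex \<Rightarrow> 'a::separable_hilbert" and r :: "complex \<Rightarrow> 'b::separable_hilbert"
  assumes s: "vholomorphic_on s U" and r: "vholomorphic_on r U" and U: "open U" "convex U"
    and snz: "\<And>w. w \<in> U \<Longrightarrow> s w \<noteq> 0" and rnz: "\<And>w. w \<in> U \<Longrightarrow> r w \<noteq> 0"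
    and curv: "\<And>w. w \<in> U \<Longrightarrow> section_curvature s w = section_curvature r w"
  shows "\<exists>\<phi>. \<phi> holomorphic_on U \<and> (\<forall>w\<in>U. \<phi> w \<noteq> 0 \<and> norm (r w) = cmod (\<phi> w) * norm (s w))"
proof -
  \<comment> \<open>The \<open>d_zbar\<close> derivative of the logarithm of the squared norm ratio;
    equality of the curvatures says that its \<open>d_z\<close> derivative is zero, so its conjugate
    is holomorphic.\<close>
  define k where "k w = conn r w - conn s w" for w
  have "\<exists>c. ((\<lambda>w. cnj (k w)) has_field_derivative c) (at w)" if w: "w \<in> U" for w
  proof -
    obtain a b where ab: "has_wirtinger (conn s) a b w"
      using wirtinger_conn[OF s U(1) w snz[OF w]] by blast
    obtain a' b' where ab': "has_wirtinger (conn r) a' b' w"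
      using wirtinger_conn[OF r U(1) w rnz[OF w]] by blast
    have "a = a'"
      using curv[OF w] section_curvature_eq[OF s U(1) w snz ab] section_curvature_eq[OF r U(1) w rnz ab']
      by simp
    then have "has_wirtinger k 0 (b' - b) w"
      using wirtinger_diff[OF ab' ab] by (simp add: k_def[abs_def])
    from wirtinger_cnj[OF this] show ?thesis by (auto simp: wirtinger_holomorphic_iff)
  qed
  then have "(\<lambda>w. cnj (k w)) holomorphic_on U"
    using U(1) by (simp add: holomorphic_on_open)
  then obtain G where G: "\<And>w. w \<in> U \<Longrightarrow> (G has_field_derivative cnj (k w)) (at w within U)"
    using holomorphic_convex_primitive'[OF U(2,1)] by blast
  have Gw: "has_wirtinger G (cnj (k w)) 0 w" if "w \<in> U" for w
    using G[OF that] at_within_open[OF that U(1)] by (simp add: wirtinger_holomorphic_iff)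
  define P where "P w = complex_of_real (ln ((norm (r w))\<^sup>2)) - complex_of_real (ln ((norm (s w))\<^sup>2))
      - (G w + cnj (G w))" for w
  have "(P has_derivative (\<lambda>h. 0)) (at w within U)" if w: "w \<in> U" for w
  proof -
    have "has_wirtinger P (cnj (conn r w) - cnj (conn s w) - (cnj (k w) + cnj 0))
        (conn r w - conn s w - (0 + cnj (cnj (k w)))) w"
      unfolding P_def[abs_def]
      by (intro wirtinger_diff wirtinger_add wirtinger_cnj Gw w
          wirtinger_ln_norm_conn[OF s U(1) w snz[OF w]] wirtinger_ln_norm_conn[OF r U(1) w rnz[OF w]])
    then show ?thesis by (simp add: k_def has_wirtinger_def has_derivative_at_withinI)
  qed
  then obtain c where c: "\<And>w. w \<in> U \<Longrightarrow> P w = c"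
    using has_derivative_zero_constant[OF U(2)] by blast
  \<comment> \<open>The logarithm of the squared ratio is \<open>2 * Re (G w) + Re c\<close>; half
    of it is the real part of this exponent.\<close>
  define \<phi> where "\<phi> w = exp (G w + c / 2)" for w
  have "norm (r w) = cmod (\<phi> w) * norm (s w)" if w: "w \<in> U" for w
  proof -
    have "Re (P w) = ln ((norm (r w))\<^sup>2) - ln ((norm (s w))\<^sup>2) - 2 * Re (G w)"
      by (simp add: P_def)
    with c[OF w] have "2 * ln (norm (r w)) = 2 * ln (norm (s w)) + 2 * Re (G w) + Re c"
      using snz[OF w] rnz[OF w] by (simp add: ln_realpow)
    then have "ln (norm (r w)) = Re (G w + c / 2) + ln (norm (s w))" by simp
    then have "exp (ln (norm (r w))) = exp (Re (G w + c / 2)) * exp (ln (norm (s w)))"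
      by (simp only: exp_add)
    then show ?thesis using snz[OF w] rnz[OF w] by (simp add: \<phi>_def)
  qed
  moreover have "G holomorphic_on U"
    using G by (auto simp: holomorphic_on_def field_differentiable_def)
  then have "\<phi> holomorphic_on U"
    unfolding \<phi>_def by (intro holomorphic_intros)
  ultimately show ?thesis by (intro exI[of _ \<phi>]) (auto simp: \<phi>_def)
qed

text \<open>
  Differentiating the identity on the diagonal in the holomorphic variable only shows that all
  derivatives of the first argument agree as well.
\<close>

lemma holomorphic_polarization:
  fixes s :: "complex \<Rightarrow> 'a::separable_hilbert" and r :: "complex \<Rightarrow> 'b::separable_hilbert"
  assumes s: "vholomorphic_on s U" and r: "vholomorphic_on r U" and U: "open U" "connected U"
    and eq: "\<And>w. w \<in> U \<Longrightarrow> norm (s w) = norm (r w)" and z: "z \<in> U" and w: "w \<in> U"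
  shows "cinner (s z) (s w) = cinner (r z) (r w)"
proof -
  have diag: "cinner ((vderiv ^^ m) s w) (s w) = cinner ((vderiv ^^ m) r w) (r w)" if "w \<in> U" for m w
    using that
  proof (induction m arbitrary: w)
    case 0
    then show ?case by (simp add: cinner_self eq)
  next
    case (Suc m)
    note ds = vholomorphic_has_derivative[OF _ U(1) Suc.prems]
    have "has_wirtinger (\<lambda>w. cinner ((vderiv ^^ m) s w) (s w))
        (cinner (vderiv ((vderiv ^^ m) s) w) (s w)) (cinner ((vderiv ^^ m) s w) (vderiv s w)) w"
      by (intro wirtinger_cinner ds s vholomorphic_funpow_vderiv U)
    then have "has_wirtinger (\<lambda>w. cinner ((vderiv ^^ m) r w) (r w))
        (cinner (vderiv ((vderiv ^^ m) s) w) (s w)) (cinner ((vderiv ^^ m) s w) (vderiv s w)) w"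
      by (rule wirtinger_transform[OF _ U(1) Suc.prems Suc.IH])
    moreover have "has_wirtinger (\<lambda>w. cinner ((vderiv ^^ m) r w) (r w))
        (cinner (vderiv ((vderiv ^^ m) r) w) (r w)) (cinner ((vderiv ^^ m) r w) (vderiv r w)) w"
      by (intro wirtinger_cinner ds r vholomorphic_funpow_vderiv U)
    ultimately have "cinner (vderiv ((vderiv ^^ m) s) w) (s w) = cinner (vderiv ((vderiv ^^ m) r) w) (r w)"
      by (rule wirtinger_unique[THEN conjunct1])
    then show ?case by simp
  qed
  let ?f = "\<lambda>z. cinner (s z) (s w)" and ?g = "\<lambda>z. cinner (r z) (r w)"
  \<comment> \<open>With the second argument frozen at \<open>w\<close>, both pairings are
    holomorphic in \<open>z\<close> and have the same Taylor coefficients at \<open>w\<close>; the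
    identity theorem does the rest.\<close>
  have "(deriv ^^ m) (\<lambda>z. ?f z - ?g z) w = 0" for m
    using higher_deriv_diff[OF cinner_vholomorphic[OF s U(1)] cinner_vholomorphic[OF r U(1)] U(1) w]
    by (simp add: higher_deriv_cinner[OF s U(1) w] higher_deriv_cinner[OF r U(1) w] diag w)
  then have "?f z - ?g z = 0"
    by (intro holomorphic_fun_eq_0_on_connected[OF _ U _ w z, of "\<lambda>z. ?f z - ?g z"]
        holomorphic_intros cinner_vholomorphic s r U)
  then show ?thesis by simp
qed

subsection \<open>Hilbert space geometry\<close>

text \<open>By the parallelogram law, two points almost nearest to \<open>x\<close> are close to
  each other, because their midpoint is not nearer than \<open>d\<close>.\<close>

lemma norm_midpoint_ge_parallelogram:
  fixes x u v :: "'a::real_inner"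
  assumes "d \<le> norm (x - (1 / 2) *\<^sub>R (u + v))" "0 \<le> d"
    and "norm (x - u) \<le> e" "norm (x - v) \<le> e"
  shows "(norm (u - v))\<^sup>2 \<le> 4 * (e\<^sup>2 - d\<^sup>2)"
proof -
  define p where "p = norm (x - (1 / 2) *\<^sub>R (u + v))"
  have "(norm (u - v))\<^sup>2 + 4 * p\<^sup>2 = 2 * (norm (x - u))\<^sup>2 + 2 * (norm (x - v))\<^sup>2"
    unfolding p_def
    by (simp add: power2_norm_eq_inner inner_diff_left inner_diff_right inner_add_left inner_add_right
        inner_commute algebra_simps)
  moreover have "d\<^sup>2 \<le> p\<^sup>2" using assms unfolding p_def by (intro power_mono)
  moreover have "(norm (x - u))\<^sup>2 \<le> e\<^sup>2" "(norm (x - v))\<^sup>2 \<le> e\<^sup>2"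
    using assms by (auto intro: power_mono)
  ultimately show ?thesis by (simp add: right_diff_distrib)
qed

lemma minimal_distance_orthogonal:
  fixes z m :: "'a::complex_inner"
  assumes min: "\<And>c. norm z \<le> norm (z - c *\<^sub>C m)"
  shows "cinner m z = 0"
proof (rule ccontr)
  assume nz: "cinner m z \<noteq> 0"
  then have m: "m \<noteq> 0" by auto
  define N where "N = (norm m)\<^sup>2"
  have N: "N > 0" using m by (simp add: N_def)
  \<comment> \<open>The coefficient of the orthogonal projection of \<open>z\<close> onto the line
    through \<open>m\<close>; subtracting that projection would shorten \<open>z\<close>.\<close>
  define c where "c = cnj (cinner m z) / complex_of_real N"
  have "cinner (z - c *\<^sub>C m) (z - c *\<^sub>C m) = cinner z z - complex_of_real ((cmod (cinner m z))\<^sup>2 / N)"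
  proof -
    have 1: "cinner z m = cnj (cinner m z)" by (rule cinner_commute)
    have "cinner (z - c *\<^sub>C m) (z - c *\<^sub>C m)
        = cinner z z - c * cinner m z - cnj c * cnj (cinner m z) + c * cnj c * complex_of_real N"
      by (simp add: cinner_diff_left cinner_diff_right cinner_scaleC_left cinner_scaleC_right 1
          cinner_self[of m] N_def algebra_simps)
    also have "\<dots> = cinner z z - cinner m z * cnj (cinner m z) / complex_of_real N"
      using N by (simp add: c_def field_simps)
    finally show ?thesis by (simp add: complex_norm_square[symmetric])
  qed
  then have "complex_of_real ((norm (z - c *\<^sub>C m))\<^sup>2)
      = complex_of_real ((norm z)\<^sup>2 - (cmod (cinner m z))\<^sup>2 / N)"
    by (simp add: cinner_self)
  then have "(norm (z - c *\<^sub>C m))\<^sup>2 = (norm z)\<^sup>2 - (cmod (cinner m z))\<^sup>2 / N"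
    by (simp only: of_real_eq_iff)
  moreover have "(cmod (cinner m z))\<^sup>2 / N > 0" using nz N by simp
  ultimately have "(norm (z - c *\<^sub>C m))\<^sup>2 < (norm z)\<^sup>2" by simp
  then show False using min[of c] by (meson norm_ge_zero not_less power_mono)
qed

text \<open>The difference of \<open>x\<close> and its nearest point in \<open>M\<close> works. An
  almost minimizing sequence is Cauchy by the parallelogram law, and its limit is the nearest
  point.\<close>

lemma orthogonal_vector_exists:
  fixes M :: "'a::separable_hilbert set"
  assumes M: "csubspace M" "closed M" and x: "x \<notin> M"
  shows "\<exists>z. z \<noteq> 0 \<and> (\<forall>m\<in>M. cinner m z = 0)"
proof -
  have ne: "M \<noteq> {}" using complex_vector.subspace_0[OF M(1)] by auto
  define d where "d = infdist x M"
  have d0: "d \<ge> 0" by (simp add: d_def infdist_nonneg)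
  have d: "d \<le> norm (x - m)" if "m \<in> M" for m
    using infdist_le[OF that, of x] by (simp add: d_def dist_norm)
  have "\<exists>m\<in>M. norm (x - m) < d + inverse (real (Suc n))" for n
  proof (rule ccontr)
    assume "\<not> ?thesis"
    then have "d + inverse (real (Suc n)) \<le> infdist x M"
      unfolding infdist_notempty[OF ne] by (intro cINF_greatest ne) (auto simp: dist_norm not_less)
    then show False by (simp add: d_def)
  qed
  then obtain m where m: "\<And>n. m n \<in> M" "\<And>n. norm (x - m n) < d + inverse (real (Suc n))"
    by metis
  have halfsum: "(1 / 2) *\<^sub>R (u + v) \<in> M" if "u \<in> M" "v \<in> M" for u v
    unfolding scaleR_scaleC by (intro complex_vector.subspace_scale complex_vector.subspace_add M that)
  have "Cauchy m"
  proof (rule metric_CauchyI)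
    fix e :: real assume e: "e > 0"
    have "(\<lambda>n. 4 * ((d + inverse (real (Suc n)))\<^sup>2 - d\<^sup>2)) \<longlonglongrightarrow> 4 * ((d + 0)\<^sup>2 - d\<^sup>2)"
      by (intro tendsto_intros LIMSEQ_inverse_real_of_nat)
    then have "\<forall>\<^sub>F n in sequentially. 4 * ((d + inverse (real (Suc n)))\<^sup>2 - d\<^sup>2) < e\<^sup>2"
      by (rule order_tendstoD) (use e in simp)
    then obtain N where N: "4 * ((d + inverse (real (Suc N)))\<^sup>2 - d\<^sup>2) < e\<^sup>2"
      unfolding eventually_sequentially by blast
    have "dist (m i) (m j) < e" if "i \<ge> N" "j \<ge> N" for i j
    proof -
      have mono: "norm (x - m k) \<le> d + inverse (real (Suc N))" if "k \<ge> N" for k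
      proof -
        have "inverse (real (Suc k)) \<le> inverse (real (Suc N))"
          using that by (intro le_imp_inverse_le) auto
        with m(2)[of k] show ?thesis by linarith
      qed
      have "(norm (m i - m j))\<^sup>2 \<le> 4 * ((d + inverse (real (Suc N)))\<^sup>2 - d\<^sup>2)"
        by (rule norm_midpoint_ge_parallelogram[OF d[OF halfsum] d0 mono mono]) (use m that in auto)
      also have "\<dots> < e\<^sup>2" by (rule N)
      finally show ?thesis using e by (simp add: dist_norm power_less_imp_less_base)
    qed
    then show "\<exists>N. \<forall>i\<ge>N. \<forall>j\<ge>N. dist (m i) (m j) < e" by blast
  qed
  then obtain p where p: "m \<longlonglongrightarrow> p" using Cauchy_convergent convergent_def by blast
  have pM: "p \<in> M" using closed_sequentially[OF M(2) m(1) p] .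
  have "norm (x - p) \<le> d"
  proof (rule LIMSEQ_le)
    show "(\<lambda>n. norm (x - m n)) \<longlonglongrightarrow> norm (x - p)" by (intro tendsto_intros p)
    have "(\<lambda>n. d + inverse (real (Suc n))) \<longlonglongrightarrow> d + 0"
      by (intro tendsto_intros LIMSEQ_inverse_real_of_nat)
    then show "(\<lambda>n. d + inverse (real (Suc n))) \<longlonglongrightarrow> d" by simp
    show "\<exists>N. \<forall>n\<ge>N. norm (x - m n) \<le> d + inverse (real (Suc n))" using m(2) less_imp_le by blast
  qed
  have "cinner y (x - p) = 0" if y: "y \<in> M" for y
  proof (rule minimal_distance_orthogonal)
    fix c
    have "p + c *\<^sub>C y \<in> M" by (intro complex_vector.subspace_scale complex_vector.subspace_add M pM y)
    from d[OF this] \<open>norm (x - p) \<le> d\<close> show "norm (x - p) \<le> norm (x - p - c *\<^sub>C y)"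
      by (simp add: diff_diff_eq)
  qed
  moreover have "x - p \<noteq> 0" using x pM by auto
  ultimately show ?thesis by blast
qed

lemma dense_cspanI:
  fixes V :: "'a::separable_hilbert set"
  assumes "\<And>x. (\<And>v. v \<in> V \<Longrightarrow> cinner v x = 0) \<Longrightarrow> x = 0"
  shows "closure (cspan V) = UNIV"
proof (rule ccontr)
  assume "closure (cspan V) \<noteq> UNIV"
  then obtain x where x: "x \<notin> closure (cspan V)" by auto
  have "csubspace (closure (cspan V))" by (intro csubspace_closure complex_vector.subspace_span)
  from orthogonal_vector_exists[OF this closed_closure x]
  obtain z where z: "z \<noteq> 0" "\<And>m. m \<in> closure (cspan V) \<Longrightarrow> cinner m z = 0" by blast
  have "v \<in> closure (cspan V)" if "v \<in> V" for v
    using that complex_vector.span_base closure_subset by blast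
  then show False using assms z by blast
qed

lemma dense_cspan_orthogonal:
  assumes "closure (cspan V) = UNIV" "\<And>v. v \<in> V \<Longrightarrow> cinner x v = 0"
  shows "x = 0"
proof -
  have "cinner v x = 0" if "v \<in> V" for v
    using assms(2)[OF that] cinner_commute[of v x] by simp
  then have "cinner x x = 0" using orthogonal_closure_cspan[of V x x] assms(1) by auto
  then show ?thesis by simp
qed

section \<open>Isometries from equal Gram matrices\<close>

text \<open>The linear extension of \<open>v i \<mapsto> v' i\<close>, kept as a relation because
  the family may be linearly dependent. Equal Gram matrices make the relation isometric, hence
  single-valued.\<close>

inductive gram_related :: "'i set \<Rightarrow> ('i \<Rightarrow> 'a::complex_inner) \<Rightarrow> ('i \<Rightarrow> 'b::complex_inner) \<Rightarrow> 'a \<Rightarrow> 'b \<Rightarrow> bool"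
  for I v v' where
  base: "i \<in> I \<Longrightarrow> gram_related I v v' (v i) (v' i)"
| zero: "gram_related I v v' 0 0"
| plus: "gram_related I v v' x y \<Longrightarrow> gram_related I v v' x' y' \<Longrightarrow> gram_related I v v' (x + x') (y + y')"
| scale: "gram_related I v v' x y \<Longrightarrow> gram_related I v v' (c *\<^sub>C x) (c *\<^sub>C y)"

lemma gram_related_cinner:
  assumes gram: "\<And>i j. i \<in> I \<Longrightarrow> j \<in> I \<Longrightarrow> cinner (v i) (v j) = cinner (v' i) (v' j)"
    and "gram_related I v v' x y" "gram_related I v v' x' y'"
  shows "cinner x x' = cinner y y'"
proof -
  have 1: "cinner x (v j) = cinner y (v' j)" if "j \<in> I" for j
    using assms(2) by induction (auto simp: gram that cinner_add_left cinner_scaleC_left)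
  show ?thesis
    using assms(3) by induction (auto simp: 1 cinner_add_right cinner_scaleC_right)
qed

lemma gram_related_diff:
  "gram_related I v v' x y \<Longrightarrow> gram_related I v v' x' y' \<Longrightarrow> gram_related I v v' (x - x') (y - y')"
  using gram_related.plus[OF _ gram_related.scale[of I v v' x' y' "-1"], of x y]
  by (simp add: complex_vector.scale_minus_left scaleC_one)

lemma gram_related_norm:
  assumes "\<And>i j. i \<in> I \<Longrightarrow> j \<in> I \<Longrightarrow> cinner (v i) (v j) = cinner (v' i) (v' j)"
    and "gram_related I v v' x y"
  shows "norm x = norm y"
proof -
  have "(norm x)\<^sup>2 = (norm y)\<^sup>2"
    using gram_related_cinner[OF assms assms(2)] unfolding cinner_self of_real_eq_iff by simp
  then show ?thesis by (metis norm_ge_zero power2_eq_imp_eq)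
qed

lemma gram_related_ex:
  assumes "x \<in> cspan (v ` I)"
  shows "\<exists>y. gram_related I v v' x y"
proof -
  have "csubspace {x. \<exists>y. gram_related I v v' x y}"
    unfolding complex_vector.subspace_def by (auto intro: gram_related.intros)
  then have "cspan (v ` I) \<subseteq> {x. \<exists>y. gram_related I v v' x y}"
    by (intro complex_vector.span_minimal) (auto intro: gram_related.intros)
  then show ?thesis using assms by auto
qed

lemma gram_transport_ex:
  fixes v :: "'i \<Rightarrow> 'a::separable_hilbert" and v' :: "'i \<Rightarrow> 'b::separable_hilbert"
  assumes gram: "\<And>i j. i \<in> I \<Longrightarrow> j \<in> I \<Longrightarrow> cinner (v i) (v j) = cinner (v' i) (v' j)"
    and dense: "closure (cspan (v ` I)) = UNIV"
  shows "\<exists>y. norm y = norm x \<and> (\<forall>i\<in>I. cinner y (v' i) = cinner x (v i))"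
proof -
  obtain f where f: "\<And>n. f n \<in> cspan (v ` I)" "f \<longlonglongrightarrow> x"
    using dense closure_sequential[of x "cspan (v ` I)"] by auto
  have "\<exists>y. gram_related I v v' (f n) y" for n by (rule gram_related_ex[OF f(1)])
  then obtain g where g: "\<And>n. gram_related I v v' (f n) (g n)" by metis
  \<comment> \<open>The relation is closed under differences, so \<open>g\<close> inherits the
    Cauchy property from \<open>f\<close>.\<close>
  have dist: "dist (g m) (g n) = dist (f m) (f n)" for m n
    using gram_related_norm[OF gram gram_related_diff[OF g g]] by (simp add: dist_norm)
  have "Cauchy g"
    using LIMSEQ_imp_Cauchy[OF f(2)] unfolding Cauchy_def dist .
  then obtain y where y: "g \<longlonglongrightarrow> y" using Cauchy_convergent convergent_def by blast
  have "(\<lambda>n. norm (g n)) = (\<lambda>n. norm (f n))" using gram_related_norm[OF gram g] by metis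
  then have "norm y = norm x"
    using tendsto_norm[OF y] tendsto_norm[OF f(2)] LIMSEQ_unique by metis
  moreover have "cinner y (v' i) = cinner x (v i)" if i: "i \<in> I" for i
  proof -
    have "(\<lambda>n. cinner (g n) (v' i)) = (\<lambda>n. cinner (f n) (v i))"
      using gram_related_cinner[OF gram g gram_related.base[OF i]] by metis
    then show ?thesis
      using tendsto_cinner[OF y tendsto_const] tendsto_cinner[OF f(2) tendsto_const] LIMSEQ_unique
      by metis
  qed
  ultimately show ?thesis by blast
qed

lemma norm_preserving_imp_cinner:
  assumes U: "cblinear U" and norm: "\<And>x. norm (U x) = norm x"
  shows "cinner (U x) (U y) = cinner x y"
proof -
  have re: "Re (cinner (U x) (U y)) = Re (cinner x y)" for x y
  proof -
    have "(norm (U (x + y)))\<^sup>2 = (norm (x + y))\<^sup>2" by (simp add: norm)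
    then have "inner (U x + U y) (U x + U y) = inner (x + y) (x + y)"
      by (simp add: cblinear_add[OF U] power2_norm_eq_inner)
    moreover have "inner (U x) (U x) = inner x x" "inner (U y) (U y) = inner y y"
      using norm by (simp_all flip: power2_norm_eq_inner)
    ultimately have "inner (U x) (U y) = inner x y"
      by (simp add: inner_add_left inner_add_right inner_commute)
    then show ?thesis by (simp add: inner_eq_Re_cinner)
  qed
  \<comment> \<open>Multiplication by \<open>- \<i>\<close> moves the imaginary part into the real
    part, where preservation is already known.\<close>
  have im: "Im (cinner u w) = Re (cinner ((- \<i>) *\<^sub>C u) w)" for u w :: "'c::complex_inner"
    unfolding cinner_scaleC_left by simp
  show ?thesis
    by (rule complex_eqI[OF re]) (simp only: im cblinear_scaleC[OF U, symmetric] re)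
qed

text \<open>The image of a vector is determined by its pairings with the dense family
  \<open>v'\<close>, so linearity follows from uniqueness alone. Surjectivity is the same transport
  with the two families exchanged.\<close>

lemma equal_gram_unitary:
  fixes v :: "'i \<Rightarrow> 'a::separable_hilbert" and v' :: "'i \<Rightarrow> 'b::separable_hilbert"
  assumes gram: "\<And>i j. i \<in> I \<Longrightarrow> j \<in> I \<Longrightarrow> cinner (v i) (v j) = cinner (v' i) (v' j)"
    and dense: "closure (cspan (v ` I)) = UNIV" and dense': "closure (cspan (v' ` I)) = UNIV"
  shows "\<exists>U. cblinear U \<and> surj U \<and> (\<forall>x y. cinner (U x) (U y) = cinner x y) \<and> (\<forall>i\<in>I. U (v i) = v' i)"
proof -
  define U where "U x = (SOME y. norm y = norm x \<and> (\<forall>i\<in>I. cinner y (v' i) = cinner x (v i)))" for x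
  have U: "norm (U x) = norm x" "\<And>i. i \<in> I \<Longrightarrow> cinner (U x) (v' i) = cinner x (v i)" for x
    using someI_ex[OF gram_transport_ex[OF gram dense, of x]] unfolding U_def by blast+
  have unique: "y = U x" if "\<And>i. i \<in> I \<Longrightarrow> cinner y (v' i) = cinner x (v i)" for x y
  proof -
    have "y - U x = 0"
      by (rule dense_cspan_orthogonal[OF dense']) (auto simp: cinner_diff_left that U)
    then show ?thesis by simp
  qed
  have lin: "cblinear U"
  proof (rule cblinearI)
    show "norm (U x) \<le> 1 * norm x" for x by (simp add: U)
    show "U (x + y) = U x + U y" for x y
      by (rule unique[symmetric]) (simp add: cinner_add_left U)
    show "U (c *\<^sub>C x) = c *\<^sub>C U x" for c x
      by (rule unique[symmetric]) (simp add: cinner_scaleC_left U)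
  qed
  moreover have "surj U"
  proof (rule surjI)
    fix y
    let ?x = "SOME x. norm x = norm y \<and> (\<forall>i\<in>I. cinner x (v i) = cinner y (v' i))"
    have "norm ?x = norm y \<and> (\<forall>i\<in>I. cinner ?x (v i) = cinner y (v' i))"
      by (rule someI_ex[OF gram_transport_ex]) (auto simp: gram dense')
    then show "U ?x = y" by (intro unique[symmetric]) auto
  qed
  moreover have "U (v i) = v' i" if "i \<in> I" for i
    by (rule unique[symmetric]) (use gram that in auto)
  ultimately show ?thesis using norm_preserving_imp_cinner[OF lin U(1)] by blast
qed

subsection \<open>A pointwise Kleinecke-Shirokov theorem\<close>

text \<open>
  Since the commutator \<open>C = D A - A D\<close> commutes with \<open>D\<close>, one has
  \<open>(D - w)\<^sup>m A\<^sup>m t w = m! (g w)\<^sup>m t w\<close>, whose norm grows only geometrically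
  in \<open>m\<close>.
\<close>

lemma commutator_eigenvalue_zero:
  fixes D A :: "'a::complex_inner \<Rightarrow> 'a"
  assumes D: "cblinear D" and A: "cblinear A"
    and AH: "\<And>x. x \<in> H \<Longrightarrow> A x \<in> H" and DH: "\<And>x. x \<in> H \<Longrightarrow> D x \<in> H" and H: "csubspace H"
    and span: "H \<subseteq> closure (cspan (t ` \<Omega>))" and tH: "\<And>w. w \<in> \<Omega> \<Longrightarrow> t w \<in> H"
    and Dt: "\<And>w. w \<in> \<Omega> \<Longrightarrow> D (t w) = w *\<^sub>C t w"
    and At: "\<And>w. w \<in> \<Omega> \<Longrightarrow> D (A (t w)) - w *\<^sub>C A (t w) = g w *\<^sub>C t w"
    and w: "w \<in> \<Omega>" "t w \<noteq> 0"
  shows "g w = 0"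
proof (rule ccontr)
  assume g: "g w \<noteq> 0"
  define E where "E x = D x - w *\<^sub>C x" for x
  define C where "C x = D (A x) - A (D x)" for x
  have E: "cblinear E"
    unfolding E_def by (intro cblinear_sub cblinear_const_scaleC D)
  have C: "cblinear C"
    unfolding C_def by (intro cblinear_sub cblinear_compose[OF A D] cblinear_compose[OF D A])
  have EH: "E x \<in> H" if "x \<in> H" for x
    unfolding E_def by (intro complex_vector.subspace_diff complex_vector.subspace_scale H DH that)
  have Ct: "C (t z) = g z *\<^sub>C t z" if "z \<in> \<Omega>" for z
    using At[OF that] by (simp add: C_def Dt that cblinear_scaleC[OF A])
  have EA: "E (A x) = A (E x) + C x" for x
    by (simp add: E_def C_def cblinear_diff[OF A] cblinear_scaleC[OF A])
  \<comment> \<open>On the frame both operators multiply \<open>t z\<close> by scalars and so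
    commute. Density extends this to \<open>H\<close> only, which is why all vectors below are kept
    in \<open>H\<close>.\<close>
  have CE: "C (E x) = E (C x)" if "x \<in> H" for x
  proof (rule cblinear_eq_on_closure_cspan[OF cblinear_compose[OF C E] cblinear_compose[OF E C]])
    show "x \<in> closure (cspan (t ` \<Omega>))" using that span by auto
    fix y assume "y \<in> t ` \<Omega>"
    then obtain z where "z \<in> \<Omega>" "y = t z" by auto
    then show "C (E y) = E (C y)"
      by (simp add: E_def Dt Ct cblinear_diff[OF C] cblinear_scaleC[OF C] cblinear_scaleC[OF D]
          scaleC_scaleC mult.commute)
  qed
  have EnH: "(E ^^ k) x \<in> H" if "x \<in> H" for k x
    using that by (induction k) (auto intro: EH)
  have CEn: "C ((E ^^ k) x) = (E ^^ k) (C x)" if "x \<in> H" for k x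
    using that by (induction k) (auto simp: CE EnH)
  \<comment> \<open>Taking commutators with \<open>A\<close> is a derivation; since \<open>C\<close>
    commutes with \<open>E\<close> on \<open>H\<close>, the \<open>k + 1\<close> product-rule terms
    coincide.\<close>
  have Leibniz: "(E ^^ Suc k) (A x) = A ((E ^^ Suc k) x) + complex_of_nat (Suc k) *\<^sub>C C ((E ^^ k) x)"
    if x: "x \<in> H" for k x
  proof (induction k)
    case 0
    then show ?case by (simp add: EA scaleC_one)
  next
    case (Suc k)
    have "(E ^^ Suc (Suc k)) (A x) = E ((E ^^ Suc k) (A x))" by simp
    also have "\<dots> = E (A ((E ^^ Suc k) x)) + complex_of_nat (Suc k) *\<^sub>C E (C ((E ^^ k) x))"
      unfolding Suc.IH by (simp only: cblinear_add[OF E] cblinear_scaleC[OF E])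
    also have "E (C ((E ^^ k) x)) = C ((E ^^ Suc k) x)" using CE[OF EnH[OF x]] by simp
    also have "E (A ((E ^^ Suc k) x)) = A ((E ^^ Suc (Suc k)) x) + C ((E ^^ Suc k) x)"
      by (simp add: EA)
    finally have "(E ^^ Suc (Suc k)) (A x) = A ((E ^^ Suc (Suc k)) x)
        + (1 *\<^sub>C C ((E ^^ Suc k) x) + complex_of_nat (Suc k) *\<^sub>C C ((E ^^ Suc k) x))"
      by (simp only: scaleC_one add.assoc)
    then show ?case by (simp only: scaleC_add_left[symmetric] of_nat_Suc)
  qed
  have AnH: "(A ^^ m) (t w) \<in> H" for m
    by (induction m) (auto intro: AH tH w)
  have key: "(E ^^ m) ((A ^^ m) (t w)) = (fact m * g w ^ m) *\<^sub>C t w" for m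
  proof (induction m)
    case 0
    then show ?case by (simp add: scaleC_one)
  next
    case (Suc m)
    have "(E ^^ Suc m) ((A ^^ Suc m) (t w)) = A ((E ^^ Suc m) ((A ^^ m) (t w)))
        + complex_of_nat (Suc m) *\<^sub>C C ((E ^^ m) ((A ^^ m) (t w)))"
      using Leibniz[OF AnH] by simp
    \<comment> \<open>By the induction hypothesis \<open>E ^^ m\<close> has already produced a
      multiple of \<open>t w\<close>, and one more \<open>E\<close> annihilates it.\<close>
    also have "(E ^^ Suc m) ((A ^^ m) (t w)) = 0"
      by (simp add: Suc.IH E_def Dt w cblinear_scaleC[OF D] scaleC_scaleC mult.commute)
    also have "C ((E ^^ m) ((A ^^ m) (t w))) = (fact m * g w ^ m) *\<^sub>C g w *\<^sub>C t w"
      by (simp add: Suc.IH cblinear_scaleC[OF C] Ct w)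
    finally show ?case
      by (simp add: scaleC_scaleC cblinear_zero[OF A] mult_ac)
  qed
  obtain K where K: "K > 0" "\<And>x. norm (E x) \<le> K * norm x" using cblinear_bound[OF E] by blast
  obtain L where L: "L > 0" "\<And>x. norm (A x) \<le> L * norm x" using cblinear_bound[OF A] by blast
  have iter: "norm ((F ^^ m) x) \<le> B ^ m * norm x"
    if "B > 0" "\<And>x. norm (F x) \<le> B * norm x" for F :: "'a \<Rightarrow> 'a" and B m x
  proof (induction m)
    case (Suc m)
    have "norm ((F ^^ Suc m) x) \<le> B * norm ((F ^^ m) x)" using that(2) by simp
    also have "\<dots> \<le> B * (B ^ m * norm x)" using that(1) Suc by (intro mult_left_mono) auto
    finally show ?case by (simp add: mult.assoc)
  qed simp
  have "fact m * cmod (g w) ^ m \<le> (K * L) ^ m" for m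
  proof -
    have "fact m * cmod (g w) ^ m * norm (t w) = norm ((E ^^ m) ((A ^^ m) (t w)))"
      by (simp add: key norm_scaleC norm_mult norm_power)
    also have "\<dots> \<le> K ^ m * norm ((A ^^ m) (t w))" by (rule iter[OF K])
    also have "\<dots> \<le> K ^ m * (L ^ m * norm (t w))" using K by (intro mult_left_mono iter[OF L]) auto
    finally show ?thesis using w by (simp add: power_mult_distrib flip: mult.assoc)
  qed
  \<comment> \<open>These are terms of an exponential series: they tend to zero and yet would all be
    at least 1.\<close>
  then have le: "1 \<le> (K * L / cmod (g w)) ^ m / fact m" for m
    using g by (simp add: power_divide field_simps)
  have "(\<lambda>m. inverse (fact m) * (K * L / cmod (g w)) ^ m) \<longlonglongrightarrow> 0"
    by (rule summable_LIMSEQ_zero[OF summable_exp])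
  then have "(\<lambda>m. (K * L / cmod (g w)) ^ m / fact m) \<longlonglongrightarrow> 0"
    by (simp add: divide_inverse mult.commute)
  then have "1 \<le> (0 :: real)" by (rule LIMSEQ_le_const) (use le in auto)
  then show False by simp
qed

subsection \<open>Operators with a flag structure\<close>

locale flag =
  fixes n :: nat and \<Omega> :: "complex set" and H :: "nat \<Rightarrow> 'a::separable_hilbert set"
    and D :: "nat \<Rightarrow> 'a \<Rightarrow> 'a" and S :: "nat \<Rightarrow> nat \<Rightarrow> 'a \<Rightarrow> 'a"
    and T :: "'a \<Rightarrow> 'a" and t :: "nat \<Rightarrow> complex \<Rightarrow> 'a"
  assumes flag_op: "flag_operator n \<Omega> H D S T"
    and frame: "flag_frame n \<Omega> H D S t"
    and n2: "2 \<le> n"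
begin

section \<open>Orthogonal projections onto the summands\<close>

lemma H_subspace: "i < n \<Longrightarrow> csubspace (H i)"
  using flag_op unfolding flag_operator_def orthogonal_direct_sum_def by blast

lemma H_orthogonal: "i < n \<Longrightarrow> j < n \<Longrightarrow> i \<noteq> j \<Longrightarrow> x \<in> H i \<Longrightarrow> y \<in> H j \<Longrightarrow> cinner x y = 0"
  using flag_op unfolding flag_operator_def orthogonal_direct_sum_def by blast

lemma H_zero: "i < n \<Longrightarrow> 0 \<in> H i"
  using H_subspace complex_vector.subspace_0 by blast

text \<open>The choice concerns the whole decomposition of \<open>x\<close> and does not depend on
  the index, so the components add up to \<open>x\<close> by construction.\<close>

definition Q :: "nat \<Rightarrow> 'a \<Rightarrow> 'a"
  where "Q i x = (SOME h. (\<forall>i<n. h i \<in> H i) \<and> x = (\<Sum>i<n. h i)) i"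

lemma Q_spec: "(\<forall>i<n. Q i x \<in> H i) \<and> x = (\<Sum>i<n. Q i x)"
proof -
  have "\<exists>h. (\<forall>i<n. h i \<in> H i) \<and> x = (\<Sum>i<n. h i)"
    using flag_op unfolding flag_operator_def orthogonal_direct_sum_def by blast
  from someI_ex[OF this] show ?thesis unfolding Q_def by simp
qed

lemma Q_in: "i < n \<Longrightarrow> Q i x \<in> H i"
  and Q_sum: "x = (\<Sum>i<n. Q i x)"
  using Q_spec by blast+

lemma Q_unique:
  assumes h: "\<And>j. j < n \<Longrightarrow> h j \<in> H j" and x: "x = (\<Sum>j<n. h j)" and i: "i < n"
  shows "Q i x = h i"
proof -
  define g where "g j = Q j x - h j" for j
  have g: "g j \<in> H j" if "j < n" for j
    unfolding g_def using that by (intro complex_vector.subspace_diff H_subspace Q_in h)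
  have "(\<Sum>j<n. g j) = 0"
    using Q_sum[of x] x by (simp add: g_def sum_subtractf)
  \<comment> \<open>Pairing the vanishing sum with its \<open>i\<close>-th term leaves only the
    squared norm of that term.\<close>
  then have "0 = (\<Sum>j<n. cinner (g j) (g i))" by (simp flip: cinner_sum_left)
  also have "\<dots> = (\<Sum>j\<in>{i}. cinner (g j) (g i))"
    by (rule sum.mono_neutral_right) (auto intro!: i H_orthogonal[OF _ i _ g g[OF i]])
  finally show ?thesis by (simp add: g_def)
qed

lemma Q_add: "i < n \<Longrightarrow> Q i (x + y) = Q i x + Q i y"
  by (rule Q_unique)
    (auto intro!: complex_vector.subspace_add H_subspace Q_in simp: sum.distrib simp flip: Q_sum)

lemma Q_scaleC: "i < n \<Longrightarrow> Q i (c *\<^sub>C x) = c *\<^sub>C Q i x"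
  by (rule Q_unique)
    (auto intro!: complex_vector.subspace_scale H_subspace Q_in
      simp flip: Q_sum complex_vector.scale_sum_right)

lemma cinner_Q_left:
  assumes "i < n" "y \<in> H i" shows "cinner x y = cinner (Q i x) y"
proof -
  have "cinner x y = (\<Sum>j<n. cinner (Q j x) y)"
    by (subst Q_sum[of x]) (simp add: cinner_sum_left)
  also have "\<dots> = (\<Sum>j\<in>{i}. cinner (Q j x) y)"
    by (rule sum.mono_neutral_right) (auto intro!: assms H_orthogonal[OF _ assms(1) _ Q_in assms(2)])
  finally show ?thesis by simp
qed

lemma norm_Q: assumes "i < n" shows "norm (Q i x) \<le> norm x"
proof (cases "Q i x = 0")
  case False
  have "(norm (Q i x))\<^sup>2 = cmod (cinner x (Q i x))"
    by (simp add: cinner_Q_left[OF assms Q_in[OF assms]] cinner_self norm_power)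
  also have "\<dots> \<le> norm x * norm (Q i x)" by (rule cinner_bound)
  finally show ?thesis using False by (simp add: power2_eq_square)
qed simp

lemma Q_cblinear: "i < n \<Longrightarrow> cblinear (Q i)"
  by (rule cblinearI[of _ 1]) (auto simp: Q_add Q_scaleC norm_Q)

lemma Q_H:
  assumes "i < n" "j < n" "x \<in> H j"
  shows "Q i x = (if i = j then x else 0)"
  by (rule Q_unique[where h = "\<lambda>i. if i = j then x else 0"]) (use assms H_zero in auto)

lemma Q_eqI: "(\<And>i. i < n \<Longrightarrow> Q i x = Q i y) \<Longrightarrow> x = y"
  by (subst Q_sum[of x], subst Q_sum[of y]) simp

section \<open>The blocks of the operator and the frame\<close>

lemma CD: "i < n \<Longrightarrow> cowen_douglas 1 \<Omega> (H i) (D i)"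
  using flag_op unfolding flag_operator_def by blast

lemma D_bounded: "i < n \<Longrightarrow> bounded_op (H i) (H i) (D i)"
  using CD unfolding cowen_douglas_def by blast

lemma S_bounded:
  assumes "Suc i < n" shows "bounded_op (H (Suc i)) (H i) (S i (Suc i))"
proof -
  have "Suc i \<in> {1..n - 1}" using assms by auto
  then have "bounded_op (H (Suc i)) (H (Suc i - 1)) (S (Suc i - 1) (Suc i))"
    using flag_op unfolding flag_operator_def by blast
  then show ?thesis by simp
qed

lemma T_cblinear: "cblinear T"
  using flag_op unfolding flag_operator_def has_operator_matrix_def by blast

lemma D_in: "i < n \<Longrightarrow> x \<in> H i \<Longrightarrow> D i x \<in> H i"
  using D_bounded unfolding bounded_op_def by blast

lemma D_scaleC: "i < n \<Longrightarrow> x \<in> H i \<Longrightarrow> D i (c *\<^sub>C x) = c *\<^sub>C D i x"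
  using D_bounded unfolding bounded_op_def by blast

lemma S_in: "Suc i < n \<Longrightarrow> x \<in> H (Suc i) \<Longrightarrow> S i (Suc i) x \<in> H i"
  using S_bounded unfolding bounded_op_def by blast

lemma S_scaleC: "Suc i < n \<Longrightarrow> x \<in> H (Suc i) \<Longrightarrow> S i (Suc i) (c *\<^sub>C x) = c *\<^sub>C S i (Suc i) x"
  using S_bounded unfolding bounded_op_def by blast

lemma S_zero: "Suc i < n \<Longrightarrow> S i (Suc i) 0 = 0"
  using S_scaleC[of i 0 0] H_zero by simp

lemma t_section: "i < n \<Longrightarrow> holomorphic_section \<Omega> (ker_shift (H i) (D i)) (t i)"
  using frame unfolding flag_frame_def by blast

lemma t_in: "i < n \<Longrightarrow> w \<in> \<Omega> \<Longrightarrow> t i w \<in> H i"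
  using t_section unfolding holomorphic_section_def ker_shift_def by blast

lemma D_t: "i < n \<Longrightarrow> w \<in> \<Omega> \<Longrightarrow> D i (t i w) = w *\<^sub>C t i w"
  using t_section unfolding holomorphic_section_def ker_shift_def by force

lemma t_holomorphic: "i < n \<Longrightarrow> vholomorphic_on (t i) \<Omega>"
  using t_section unfolding holomorphic_section_def by blast

lemma t_nonzero: "i < n \<Longrightarrow> w \<in> \<Omega> \<Longrightarrow> t i w \<noteq> 0"
  using frame unfolding flag_frame_def by blast

lemma S_t:
  assumes "Suc i < n" "w \<in> \<Omega>" shows "S i (Suc i) (t (Suc i) w) = t i w"
proof -
  have "Suc i \<in> {1..n - 1}" using assms by auto
  then have "t (Suc i - 1) w = S (Suc i - 1) (Suc i) (t (Suc i) w)"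
    using frame assms(2) unfolding flag_frame_def by blast
  then show ?thesis by simp
qed

text \<open>Here the rank one of the bundles enters: blocks that satisfy an eigenvector equation are
  thereby turned into scalar functions along the frame.\<close>

lemma eigenvector_multiple:
  assumes i: "i < n" and w: "w \<in> \<Omega>" and x: "x \<in> H i" "D i x = w *\<^sub>C x"
  shows "\<exists>c. x = c *\<^sub>C t i w"
proof (rule one_dimensional_span)
  let ?K = "ker_shift (H i) (D i) w"
  have add: "D i (y + z) = D i y + D i z" if "y \<in> H i" "z \<in> H i" for y z
    using D_bounded[OF i] that unfolding bounded_op_def by blast
  show "csubspace ?K"
    unfolding complex_vector.subspace_def ker_shift_def
    using H_zero[OF i] D_scaleC[OF i H_zero[OF i], of 0] H_subspace[OF i]
    by (auto simp: add D_scaleC[OF i] scaleC_add_right scaleC_scaleC mult.commute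
        complex_vector.subspace_add complex_vector.subspace_scale)
  show "cdim ?K = 1" using CD[OF i] w unfolding cowen_douglas_def by blast
  show "t i w \<in> ?K" using i w by (simp add: ker_shift_def t_in D_t)
  show "x \<in> ?K" using x by (simp add: ker_shift_def)
qed (rule t_nonzero[OF i w])

lemma H_span:
  assumes i: "i < n" shows "H i \<subseteq> closure (cspan (t i ` \<Omega>))"
proof -
  have "(\<Union>w\<in>\<Omega>. ker_shift (H i) (D i) w) \<subseteq> cspan (t i ` \<Omega>)"
  proof (rule UN_least, rule subsetI)
    fix w x assume w: "w \<in> \<Omega>" and "x \<in> ker_shift (H i) (D i) w"
    then obtain c where "x = c *\<^sub>C t i w"
      using eigenvector_multiple[OF i w] by (auto simp: ker_shift_def)
    then show "x \<in> cspan (t i ` \<Omega>)"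
      using w by (auto intro: complex_vector.span_scale complex_vector.span_base)
  qed
  then have "cspan (\<Union>w\<in>\<Omega>. ker_shift (H i) (D i) w) \<subseteq> cspan (t i ` \<Omega>)"
    by (intro complex_vector.span_minimal complex_vector.subspace_span)
  then show ?thesis
    using CD[OF i] closure_mono unfolding cowen_douglas_def by blast
qed

lemma eq_on_H:
  assumes "cblinear F" "cblinear G" "i < n" "\<And>w. w \<in> \<Omega> \<Longrightarrow> F (t i w) = G (t i w)" "x \<in> H i"
  shows "F x = G x"
  by (rule cblinear_eq_on_closure_cspan[OF assms(1,2), of "t i ` \<Omega>"])
    (use assms H_span in auto)

lemma eq_on_frame:
  assumes "cblinear F" "cblinear G" "\<And>i w. i < n \<Longrightarrow> w \<in> \<Omega> \<Longrightarrow> F (t i w) = G (t i w)"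
  shows "F x = G x"
proof -
  have "F (Q i x) = G (Q i x)" if "i < n" for i
    by (rule eq_on_H[OF assms(1,2) that assms(3)[OF that] Q_in[OF that]])
  then have "F (\<Sum>i<n. Q i x) = G (\<Sum>i<n. Q i x)"
    by (simp add: cblinear_sum[OF assms(1)] cblinear_sum[OF assms(2)])
  then show ?thesis by (simp flip: Q_sum)
qed

text \<open>The superdiagonal part as an operator on the whole space; on the frame it is the
  backward shift. The guard accounts for the last row, which has no superdiagonal entry.\<close>

definition N :: "'a \<Rightarrow> 'a"
  where "N x = (\<Sum>i<n. if Suc i < n then S i (Suc i) (Q (Suc i) x) else 0)"

lemma N_cblinear: "cblinear N"
  unfolding N_def
proof (rule cblinear_setsum)
  fix i
  show "cblinear (\<lambda>x. if Suc i < n then S i (Suc i) (Q (Suc i) x) else 0)"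
    by (cases "Suc i < n")
      (auto intro: bounded_op_compose_cblinear[OF S_bounded Q_cblinear Q_in] cblinear_const_0)
qed

lemma Q_N: "i < n \<Longrightarrow> Q i (N x) = (if Suc i < n then S i (Suc i) (Q (Suc i) x) else 0)"
  by (rule Q_unique[where h = "\<lambda>i. if Suc i < n then S i (Suc i) (Q (Suc i) x) else 0"])
    (auto simp: N_def S_in Q_in H_zero)

lemma N_H:
  assumes "j < n" "x \<in> H j"
  shows "N x = (if j = 0 then 0 else S (j - 1) j x)"
proof (rule Q_eqI)
  fix i assume i: "i < n"
  show "Q i (N x) = Q i (if j = 0 then 0 else S (j - 1) j x)"
  proof (cases j)
    case 0
    then show ?thesis
      using i by (auto simp: Q_N Q_H[OF _ assms] S_zero cblinear_zero[OF Q_cblinear])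
  next
    case (Suc k)
    with assms have k: "k < n" "S k (Suc k) x \<in> H k" by (auto intro: S_in)
    show ?thesis using Suc i assms(1) by (auto simp: Q_N Q_H[OF _ assms] Q_H[OF _ k] S_zero)
  qed
qed

lemma N_t: "j < n \<Longrightarrow> w \<in> \<Omega> \<Longrightarrow> N (t j w) = (if j = 0 then 0 else t (j - 1) w)"
  using S_t[of "j - 1" w] by (cases j) (simp_all add: N_H[OF _ t_in])

lemma funpow_N_t:
  "j < n \<Longrightarrow> w \<in> \<Omega> \<Longrightarrow> (N ^^ k) (t j w) = (if j < k then 0 else t (j - k) w)"
  by (induction k) (auto simp: cblinear_zero[OF N_cblinear] N_t)

lemma funpow_N_n: "(N ^^ n) x = 0"
  by (rule eq_on_frame[OF cblinear_funpow[OF N_cblinear] cblinear_const_0]) (simp add: funpow_N_t)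

lemma T_H:
  assumes j: "j < n" and x: "x \<in> H j"
  shows "T x = D j x + N x"
proof -
  have "T x = (\<Sum>i<n. bidiagonal D S i j x)"
    using flag_op j x unfolding flag_operator_def has_operator_matrix_def by blast
  also have "\<dots> = (\<Sum>i<n. (if i = j then D j x else 0) + (if Suc i = j then S i j x else 0))"
    by (intro sum.cong) (auto simp: bidiagonal_def)
  also have "\<dots> = D j x + (\<Sum>i<n. if Suc i = j then S i j x else 0)"
    using j by (simp add: sum.distrib)
  also have "(\<Sum>i<n. if Suc i = j then S i j x else 0) = N x"
  proof (cases j)
    case (Suc k)
    have "(\<Sum>i<n. if Suc i = j then S i j x else 0) = (\<Sum>i<n. if i = k then S i j x else 0)"
      by (intro sum.cong) (auto simp: Suc)
    then show ?thesis using j x Suc by (simp add: N_H)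
  qed (use j x in \<open>simp add: N_H\<close>)
  finally show ?thesis .
qed

lemma T_t: "j < n \<Longrightarrow> w \<in> \<Omega> \<Longrightarrow> T (t j w) = w *\<^sub>C t j w + N (t j w)"
  by (simp add: T_H[OF _ t_in] D_t)

text \<open>The intertwining relations between the blocks, read on the frame: \<open>D\<close>
  multiplies by \<open>w\<close>, and the shift keeps \<open>w\<close> fixed. Thus \<open>N\<close>
  is a nilpotent element of the commutant, the one to be transported later.\<close>

lemma N_T: "N (T x) = T (N x)"
proof (rule eq_on_frame[OF cblinear_compose[OF N_cblinear T_cblinear] cblinear_compose[OF T_cblinear N_cblinear]])
  fix i w assume iw: "i < n" "w \<in> \<Omega>"
  have "N (T (t i w)) = w *\<^sub>C N (t i w) + N (N (t i w))"
    by (simp add: T_t[OF iw] cblinear_add[OF N_cblinear] cblinear_scaleC[OF N_cblinear])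
  also have "\<dots> = T (N (t i w))"
    using iw by (auto simp: N_t cblinear_zero[OF N_cblinear] cblinear_zero[OF T_cblinear] T_t)
  finally show "N (T (t i w)) = T (N (t i w))" .
qed

lemma Q_T: assumes i: "i < n" shows "Q i (T x) = D i (Q i x) + Q i (N x)"
proof -
  have "T x = (\<Sum>j<n. T (Q j x))"
    by (subst Q_sum[of x]) (simp add: cblinear_sum[OF T_cblinear])
  also have "\<dots> = (\<Sum>j<n. D j (Q j x)) + (\<Sum>j<n. N (Q j x))"
    by (simp add: T_H Q_in flip: sum.distrib)
  also have "(\<Sum>j<n. N (Q j x)) = N x"
    by (simp flip: Q_sum cblinear_sum[OF N_cblinear])
  finally have "Q i (T x) = Q i (\<Sum>j<n. D j (Q j x)) + Q i (N x)"
    by (simp add: Q_add i)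
  also have "Q i (\<Sum>j<n. D j (Q j x)) = D i (Q i x)"
    by (rule Q_unique) (auto simp: i D_in Q_in)
  finally show ?thesis .
qed

section \<open>Block structure of the commutant\<close>

text \<open>Entry \<open>(i, j)\<close> of \<open>X T = T X\<close> on an eigenvector. The failure
  of this block to intertwine \<open>D j\<close> with \<open>D i\<close> is expressed by its
  neighbours to the left and below.\<close>

lemma commutant_relation:
  assumes X: "cblinear X" and comm: "\<And>x. X (T x) = T (X x)" and i: "i < n" and j: "j < n" and w: "w \<in> \<Omega>"
  shows "D i (Q i (X (t j w))) - w *\<^sub>C Q i (X (t j w)) = Q i (X (N (t j w))) - Q i (N (X (t j w)))"
proof -
  have "Q i (X (T (t j w))) = w *\<^sub>C Q i (X (t j w)) + Q i (X (N (t j w)))"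
    by (simp add: T_t j w cblinear_add[OF X] cblinear_scaleC[OF X] Q_add Q_scaleC i)
  moreover have "Q i (X (T (t j w))) = D i (Q i (X (t j w))) + Q i (N (X (t j w)))"
    by (simp add: comm Q_T i)
  ultimately show ?thesis by (simp add: algebra_simps)
qed

text \<open>The diagonals below the main one are cleared from the lower left corner upwards. Each is
  reduced to scalar functions by its own block equations; the equations one diagonal higher then
  force these functions to vanish.\<close>

lemma commutant_upper_triangular:
  assumes X: "cblinear X" and comm: "\<And>x. X (T x) = T (X x)"
    and "i < n" "j < i" "x \<in> H j"
  shows "Q i (X x) = 0"
proof -
  \<comment> \<open>Here \<open>d\<close> measures the distance below the diagonal; the induction
    runs downwards from \<open>n\<close>, where there are no entries.\<close>
  have "\<forall>i j. i < n \<longrightarrow> j + 1 \<le> i \<longrightarrow> (\<forall>x\<in>H j. Q i (X x) = 0)"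
  proof (rule inc_induct[of 1 n "\<lambda>d. \<forall>i j. i < n \<longrightarrow> j + d \<le> i \<longrightarrow> (\<forall>x\<in>H j. Q i (X x) = 0)"])
    show "1 \<le> n" using n2 by simp
    show "\<forall>i j. i < n \<longrightarrow> j + n \<le> i \<longrightarrow> (\<forall>x\<in>H j. Q i (X x) = 0)" by simp
    fix d assume d: "1 \<le> d" "d < n"
      and IH: "\<forall>i j. i < n \<longrightarrow> j + Suc d \<le> i \<longrightarrow> (\<forall>x\<in>H j. Q i (X x) = 0)"
    have below: "Q i (X x) = 0" if "i < n" "j + d < i" "x \<in> H j" for i j x
      using IH that by (metis Suc_leI add_Suc_right)
    \<comment> \<open>Both neighbours of position \<open>(j + d, j)\<close> in the block equation
      lie at distance \<open>d + 1\<close> and vanish, so the entry yields an eigenvector.\<close>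
    have "\<exists>c. Q (j + d) (X (t j w)) = c *\<^sub>C t (j + d) w" if j: "j + d < n" and w: "w \<in> \<Omega>" for j w
    proof (rule eigenvector_multiple[OF j w Q_in[OF j]])
      have "Q (j + d) (X (N (t j w))) = 0"
        using below[of "j + d" "j - 1" "t (j - 1) w"] j w
        by (auto simp: N_t t_in cblinear_zero[OF X] cblinear_zero[OF Q_cblinear])
      moreover have "Q (j + d) (N (X (t j w))) = 0"
        using j below[of "Suc (j + d)" j "t j w"] w by (auto simp: Q_N t_in S_zero)
      ultimately show "D (j + d) (Q (j + d) (X (t j w))) = w *\<^sub>C Q (j + d) (X (t j w))"
        using commutant_relation[OF X comm j _ w, of j] j by simp
    qed
    then obtain f' where f': "\<And>j w. j + d < n \<Longrightarrow> w \<in> \<Omega> \<Longrightarrow> Q (j + d) (X (t j w)) = f' j w *\<^sub>C t (j + d) w"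
      by metis
    \<comment> \<open>Row \<open>n\<close> does not exist; the value zero there agrees with the last
      row of \<open>N\<close>, so that \<open>step\<close> also covers
      \<open>j + d = n\<close>.\<close>
    define f where "f j w = (if j + d < n then f' j w else 0)" for j w
    have step: "f j w = (if j = 0 then 0 else f (j - 1) w)" if jn: "j + d \<le> n" and w: "w \<in> \<Omega>" for j w
    proof -
      \<comment> \<open>Position \<open>(i, j)\<close> is one diagonal higher, and both of its
        neighbours lie at distance exactly \<open>d\<close>. The function \<open>g\<close> is the
        difference of their scalars.\<close>
      define i where "i = j + (d - 1)"
      have i: "i < n" and j: "j < n" and Suci: "Suc i = j + d" using jn d by (auto simp: i_def)
      define g where "g w = (if j = 0 then 0 else f (j - 1) w) - f j w" for w
      have "g w = 0"
      \<comment> \<open>The block \<open>(i, j)\<close> does not act within one summand. As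
        \<open>N ^^ (d - 1)\<close> carries \<open>t i\<close> to \<open>t j\<close>, composing with
        it gives an operator on \<open>H i\<close> whose commutator with \<open>D i\<close> is
        multiplication by \<open>g\<close> on the frame.\<close>
      proof (rule commutator_eigenvalue_zero[where D = "\<lambda>x. D i (Q i x)" and H = "H i" and t = "t i"
            and A = "\<lambda>x. Q i (X ((N ^^ (d - 1)) x))" and \<Omega> = \<Omega>
            and g = g and w = w])
        show "cblinear (\<lambda>x. D i (Q i x))"
          by (rule bounded_op_compose_cblinear[OF D_bounded Q_cblinear Q_in]) (rule i)+
        show "cblinear (\<lambda>x. Q i (X ((N ^^ (d - 1)) x)))"
          by (rule cblinear_compose[OF Q_cblinear[OF i] cblinear_compose[OF X cblinear_funpow[OF N_cblinear]]])
        show "D i (Q i (Q i (X ((N ^^ (d - 1)) (t i z))))) - z *\<^sub>C Q i (X ((N ^^ (d - 1)) (t i z)))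
            = g z *\<^sub>C t i z" if z: "z \<in> \<Omega>" for z
        proof -
          have Nt: "(N ^^ (d - 1)) (t i z) = t j z" using i z by (simp add: funpow_N_t) (simp add: i_def)
          have 1: "Q i (X (N (t j z))) = (if j = 0 then 0 else f (j - 1) z) *\<^sub>C t i z"
          proof (cases j)
            case (Suc k)
            then have k: "k + d = i" "k + d < n" using Suci i by auto
            show ?thesis using f'[OF k(2) z] k j z Suc by (simp add: N_t f_def)
          qed (use j z i in \<open>simp add: N_t cblinear_zero[OF X] cblinear_zero[OF Q_cblinear]\<close>)
          have 2: "Q i (N (X (t j z))) = f j z *\<^sub>C t i z"
            using f'[of j z] i z by (simp add: Q_N f_def Suci[symmetric] S_scaleC t_in S_t)
          show ?thesis
            using commutant_relation[OF X comm i j z] i j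
            unfolding Nt 1 2 g_def by (simp add: Q_H[OF _ _ Q_in] scaleC_diff_left)
        qed
        show "D i (Q i (t i z)) = z *\<^sub>C t i z" if "z \<in> \<Omega>" for z
          using that i by (simp add: Q_H t_in D_t)
      qed (auto simp: i w Q_in D_in H_subspace H_span t_in t_nonzero)
      then show ?thesis by (simp add: g_def)
    qed
    \<comment> \<open>Neighbouring entries of the diagonal agree, and the chain starts with zero
      because \<open>N\<close> annihilates \<open>t 0\<close>.\<close>
    have f0: "f j w = 0" if "j + d \<le> n" "w \<in> \<Omega>" for j w
      using that by (induction j) (auto simp: step)
    have "Q (j + d) (X x) = 0" if j: "j + d < n" and x: "x \<in> H j" for j x
    proof (rule eq_on_H[OF cblinear_compose[OF Q_cblinear[OF j] X] cblinear_const_0 _ _ x])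
      show "Q (j + d) (X (t j w)) = 0" if "w \<in> \<Omega>" for w
        using f'[OF j that] f0[of j w] j that by (simp add: f_def)
    qed (use j in simp)
    then show "\<forall>i j. i < n \<longrightarrow> j + d \<le> i \<longrightarrow> (\<forall>x\<in>H j. Q i (X x) = 0)"
      using below by (metis le_neq_implies_less)
  qed
  then show ?thesis using assms(3-5) by (simp add: Suc_le_eq)
qed

lemma Q_block_sum:
  assumes X: "cblinear X" and i: "i < n"
  shows "Q i (X y) = (\<Sum>l<n. Q i (X (Q l y)))"
  by (subst Q_sum[of y]) (simp add: cblinear_sum[OF X] cblinear_sum[OF Q_cblinear[OF i]])

text \<open>Only the diagonal is left. Its entries are scalars \<open>h\<close> on the frame, and
  for a triangular operator the diagonal of a power consists of the powers of \<open>h\<close>;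
  nilpotency makes them zero.\<close>

lemma nilpotent_commutant_strictly_upper_triangular:
  assumes X: "cblinear X" and comm: "\<And>x. X (T x) = T (X x)" and nil: "\<And>x. (X ^^ m) x = 0"
    and ij: "i < n" "j \<le> i" and x: "x \<in> H j"
  shows "Q i (X x) = 0"
proof (cases "j < i")
  case True
  then show ?thesis using commutant_upper_triangular[OF X comm] ij x by blast
next
  case False
  with ij have [simp]: "i = j" and j: "j < n" by auto
  have "Q j (X (t j w)) = 0" if w: "w \<in> \<Omega>" for w
  proof -
    note upper = commutant_upper_triangular[OF X comm]
    have "\<exists>h. Q j (X (t j w)) = h *\<^sub>C t j w"
    proof (rule eigenvector_multiple[OF j w Q_in[OF j]])
      have "Q j (X (N (t j w))) = 0"
        using upper[of j "j - 1" "t (j - 1) w"] j w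
        by (auto simp: N_t t_in cblinear_zero[OF X] cblinear_zero[OF Q_cblinear])
      moreover have "Q j (N (X (t j w))) = 0"
        using j upper[of "Suc j" j "t j w"] w by (auto simp: Q_N t_in S_zero)
      ultimately show "D j (Q j (X (t j w))) = w *\<^sub>C Q j (X (t j w))"
        using commutant_relation[OF X comm j j w] by simp
    qed
    then obtain h where h: "Q j (X (t j w)) = h *\<^sub>C t j w" by blast
    \<comment> \<open>The vanishing of the later components is carried along in the induction: it
      removes the terms \<open>l > j\<close> from the block sum, while triangularity removes the
      terms \<open>l < j\<close>.\<close>
    have "Q j ((X ^^ k) (t j w)) = h ^ k *\<^sub>C t j w \<and> (\<forall>i<n. j < i \<longrightarrow> Q i ((X ^^ k) (t j w)) = 0)" for k
    proof (induction k)
      case 0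
      then show ?case using j w by (simp add: Q_H t_in scaleC_one)
    next
      case (Suc k)
      let ?y = "(X ^^ k) (t j w)"
      have "Q j (X ?y) = (\<Sum>l<n. Q j (X (Q l ?y)))" by (rule Q_block_sum[OF X j])
      also have "\<dots> = (\<Sum>l\<in>{j}. Q j (X (Q l ?y)))"
      proof (rule sum.mono_neutral_right)
        show "\<forall>l\<in>{..<n} - {j}. Q j (X (Q l ?y)) = 0"
        proof
          fix l assume l: "l \<in> {..<n} - {j}"
          show "Q j (X (Q l ?y)) = 0"
          proof (cases "l < j")
            case True
            then show ?thesis using upper[OF j True Q_in] l by simp
          next
            case False
            then show ?thesis
              using Suc.IH l by (simp add: cblinear_zero[OF X] cblinear_zero[OF Q_cblinear[OF j]])
          qed
        qed
      qed (use j in auto)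
      also have "\<dots> = h ^ Suc k *\<^sub>C t j w"
        using Suc.IH j by (simp add: cblinear_scaleC[OF X] Q_scaleC h scaleC_scaleC mult.commute)
      finally have "Q j ((X ^^ Suc k) (t j w)) = h ^ Suc k *\<^sub>C t j w" by simp
      moreover have "Q i ((X ^^ Suc k) (t j w)) = 0" if i: "i < n" "j < i" for i
      proof -
        have "Q i (X (Q l ?y)) = 0" if l: "l < n" for l
        proof (cases "l < i")
          case True
          then show ?thesis using upper[OF i(1) True Q_in] l by simp
        next
          case False
          then show ?thesis
            using Suc.IH l i by (simp add: cblinear_zero[OF X] cblinear_zero[OF Q_cblinear[OF i(1)]])
        qed
        then show ?thesis using Q_block_sum[OF X i(1), of ?y] by simp
      qed
      ultimately show ?case by blast
    qed
    from this[of m] have "h ^ m *\<^sub>C t j w = 0"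
      by (simp add: nil cblinear_zero[OF Q_cblinear[OF j]])
    then have "h = 0" using t_nonzero[OF j w] by simp
    with h show ?thesis by simp
  qed
  then have "Q j (X x) = 0"
    by (intro eq_on_H[OF cblinear_compose[OF Q_cblinear[OF j] X] cblinear_const_0 j _ x])
  then show ?thesis by simp
qed

text \<open>Each factor moves every component at least one summand up, so \<open>k\<close> factors
  clear the last \<open>k\<close> components.\<close>

lemma strictly_upper_triangular_funpow:
  assumes X: "cblinear X" and strict: "\<And>i j x. i < n \<Longrightarrow> j \<le> i \<Longrightarrow> x \<in> H j \<Longrightarrow> Q i (X x) = 0"
    and "i < n" "n \<le> i + k"
  shows "Q i ((X ^^ k) x) = 0"
  using assms(3,4)
proof (induction k arbitrary: i)
  case (Suc k)
  let ?y = "(X ^^ k) x"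
  have "Q i (X (Q l ?y)) = 0" if l: "l < n" for l
  proof (cases "l \<le> i")
    case True
    then show ?thesis using strict Suc.prems Q_in l by blast
  next
    case False
    then show ?thesis
      using Suc.IH[OF l] Suc.prems
      by (simp add: cblinear_zero[OF X] cblinear_zero[OF Q_cblinear])
  qed
  then show ?case using Q_block_sum[OF X Suc.prems(1), of ?y] by simp
qed simp

text \<open>The empty set counts as connected, so a point of \<open>\<Omega>\<close> has to come
  from the operator: over an empty domain all summands would be trivial, against a non-zero
  \<open>S 0 1\<close>.\<close>

lemma \<Omega>_nonempty: "\<Omega> \<noteq> {}"
proof
  assume "\<Omega> = {}"
  moreover have "H 1 \<subseteq> closure (cspan (t 1 ` \<Omega>))" using n2 by (intro H_span) simp
  ultimately have "H 1 \<subseteq> {0}" by simp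
  moreover have "1 \<in> {1..n - 1}" using n2 by auto
  then have "\<exists>x\<in>H 1. S (1 - 1) 1 x \<noteq> 0"
    using flag_op unfolding flag_operator_def by blast
  ultimately show False using S_zero[of 0] n2 by auto
qed

text \<open>The global section \<open>t 0\<close> is an admissible witness at every point, and by
  rank one any other local section is proportional to it.\<close>

lemma curvature_frame:
  assumes z: "z \<in> \<Omega>" and \<Omega>: "open \<Omega>"
  shows "curvature \<Omega> (H 0) (D 0) z = section_curvature (t 0) z"
  unfolding curvature_def
proof (rule the_equality)
  have 0: "0 < n" using n2 by simp
  show "\<exists>U \<gamma>. open U \<and> z \<in> U \<and> U \<subseteq> \<Omega> \<and> holomorphic_section U (ker_shift (H 0) (D 0)) \<gamma> \<and>
      (\<forall>w\<in>U. \<gamma> w \<noteq> 0) \<and> section_curvature (t 0) z = section_curvature \<gamma> z"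
    using assms t_section[OF 0] t_nonzero[OF 0] by blast
  fix k
  assume "\<exists>U \<gamma>. open U \<and> z \<in> U \<and> U \<subseteq> \<Omega> \<and> holomorphic_section U (ker_shift (H 0) (D 0)) \<gamma> \<and>
      (\<forall>w\<in>U. \<gamma> w \<noteq> 0) \<and> k = section_curvature \<gamma> z"
  then obtain U \<gamma> where U: "open U" "z \<in> U" "U \<subseteq> \<Omega>"
    and \<gamma>: "holomorphic_section U (ker_shift (H 0) (D 0)) \<gamma>" "\<And>w. w \<in> U \<Longrightarrow> \<gamma> w \<noteq> 0"
    and k: "k = section_curvature \<gamma> z" by blast
  have "\<exists>c. \<gamma> w = c *\<^sub>C t 0 w" if "w \<in> U" for w
    using \<gamma>(1) that U(3) by (intro eigenvector_multiple[OF 0]) (auto simp: holomorphic_section_def ker_shift_def)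
  moreover have "vholomorphic_on \<gamma> U" using \<gamma>(1) by (simp add: holomorphic_section_def)
  ultimately show "k = section_curvature (t 0) z"
    unfolding k using U t_nonzero[OF 0] \<gamma>(2)
    by (intro section_curvature_proportional[OF vholomorphic_on_subset[OF t_holomorphic[OF 0] U(3)]]) auto
qed

end

subsection \<open>Intertwining operators and unitary equivalence\<close>

text \<open>
  The operator \<open>V N' W\<close> commutes with \<open>T\<close> and is nilpotent, hence strictly upper
  triangular. Its powers have the same range as \<open>V N'\<^sup>k\<close>, and the range of
  \<open>N'\<^sup>k\<close> is dense in the first \<open>n - k\<close> summands.
\<close>

lemma intertwiner_upper_triangular:
  assumes A: "flag n \<Omega> H D S T t" and B: "flag n \<Omega> H' D' S' T' t'"
    and V: "cblinear V" and W: "cblinear W" and VW: "\<And>x. V (W x) = x" and WV: "\<And>y. W (V y) = y"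
    and VT: "\<And>y. V (T' y) = T (V y)"
    and ij: "i < n" "j < i" and y: "y \<in> H' j"
  shows "flag.Q n H i (V y) = 0"
proof -
  interpret A: flag n \<Omega> H D S T t by fact
  interpret B: flag n \<Omega> H' D' S' T' t' by fact
  have WT: "W (T x) = T' (W x)" for x
    by (metis VT VW WV)
  define X where "X x = V (B.N (W x))" for x
  have X: "cblinear X"
    unfolding X_def by (rule cblinear_compose[OF V cblinear_compose[OF B.N_cblinear W]])
  have comm: "X (T x) = T (X x)" for x
    by (simp add: X_def WT B.N_T VT)
  have pow: "(X ^^ k) x = V ((B.N ^^ k) (W x))" for k x
    by (induction k) (simp_all add: VW WV X_def)
  have nil: "(X ^^ n) x = 0" for x
    by (simp add: pow B.funpow_N_n cblinear_zero[OF V])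
  have zero: "A.Q i (V ((B.N ^^ k) y)) = 0" if "n \<le> i + k" for k y
  proof -
    have "A.Q i ((X ^^ k) (V y)) = 0"
      by (rule A.strictly_upper_triangular_funpow[OF X
            A.nilpotent_commutant_strictly_upper_triangular[OF X comm nil] ij(1) that])
    then show ?thesis by (simp add: pow WV)
  qed
  have j: "j < n" using ij by simp
  show ?thesis
  proof (rule B.eq_on_H[OF cblinear_compose[OF A.Q_cblinear[OF ij(1)] V] cblinear_const_0 j _ y])
    fix w assume "w \<in> \<Omega>"
    \<comment> \<open>Every frame vector is a shifted copy of the last one, by
      \<open>n - 1 - j\<close> places. Since \<open>j < i\<close>, this exponent satisfies
      \<open>n \<le> i + (n - 1 - j)\<close>, as \<open>zero\<close> requires.\<close>
    then have "t' j w = (B.N ^^ (n - 1 - j)) (t' (n - 1) w)"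
      using j B.funpow_N_t[of "n - 1" w "n - 1 - j"] by auto
    then show "A.Q i (V (t' j w)) = 0" using zero[of "n - 1 - j"] ij by simp
  qed
qed

text \<open>The inverse \<open>W\<close> is also the adjoint of \<open>V\<close>. Triangularity of
  \<open>V\<close> removes the entries below the diagonal, and triangularity of \<open>W\<close>
  removes those above it.\<close>

lemma unitary_preserves_summands:
  assumes A: "flag n \<Omega> H D S T t" and B: "flag n \<Omega> H' D' S' T' t'"
    and V: "cblinear V" and W: "cblinear W" and VW: "\<And>x. V (W x) = x" and WV: "\<And>y. W (V y) = y"
    and inner: "\<And>x y. cinner (V x) (V y) = cinner x y" and VT: "\<And>y. V (T' y) = T (V y)"
    and j: "j < n" and y: "y \<in> H' j"
  shows "V y \<in> H j"
proof -
  interpret A: flag n \<Omega> H D S T t by fact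
  interpret B: flag n \<Omega> H' D' S' T' t' by fact
  have WT: "W (T x) = T' (W x)" for x
    by (metis VT VW WV)
  have "A.Q i (V y) = 0" if i: "i < n" "i \<noteq> j" for i
  proof (cases "j < i")
    case True
    then show ?thesis using intertwiner_upper_triangular[OF A B V W VW WV VT i(1) _ y] by blast
  next
    case False
    with i have ij: "i < j" by simp
    define x where "x = A.Q i (V y)"
    have x: "x \<in> H i" using i by (simp add: x_def A.Q_in)
    have "B.Q j (W x) = 0"
      by (rule intertwiner_upper_triangular[OF B A W V WV VW WT j ij x])
    then have "cinner (W x) y = 0" using B.cinner_Q_left[OF j y, of "W x"] by simp
    then have "cinner x (V y) = 0" using inner[of "W x" y] by (simp add: VW)
    then have "cinner (V y) x = 0" using cinner_commute[of "V y" x] by simp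
    then have "cinner x x = 0" using A.cinner_Q_left[OF i(1) x, of "V y"] by (simp add: x_def)
    then show ?thesis by (simp add: x_def)
  qed
  then have "A.Q i (V y) = A.Q i (A.Q j (V y))" if "i < n" for i
    using that by (simp add: A.Q_H[OF _ j A.Q_in[OF j]])
  then have "V y = A.Q j (V y)"
    by (rule A.Q_eqI)
  then show ?thesis using A.Q_in[OF j] by metis
qed

section \<open>Invariance under unitary equivalence\<close>

lemma section_curvature_isometry:
  assumes "\<And>x. norm (U x) = norm x"
  shows "section_curvature (\<lambda>w. U (\<gamma> w)) z = section_curvature \<gamma> z"
  by (simp add: section_curvature_def assms)

lemma curvature_local_value_transfer:
  assumes U: "cblinear U" and norm: "\<And>x. norm (U x) = norm x"
    and K: "\<And>x. x \<in> K \<Longrightarrow> U x \<in> K'" and A: "\<And>x. x \<in> K \<Longrightarrow> U (A x) = A' (U x)"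
    and k: "\<exists>V \<gamma>. open V \<and> z \<in> V \<and> V \<subseteq> \<Omega> \<and> holomorphic_section V (ker_shift K A) \<gamma> \<and>
       (\<forall>w\<in>V. \<gamma> w \<noteq> 0) \<and> k = section_curvature \<gamma> z"
  shows "\<exists>V \<gamma>. open V \<and> z \<in> V \<and> V \<subseteq> \<Omega> \<and> holomorphic_section V (ker_shift K' A') \<gamma> \<and>
       (\<forall>w\<in>V. \<gamma> w \<noteq> 0) \<and> k = section_curvature \<gamma> z"
proof -
  from k obtain V \<gamma> where V: "open V" "z \<in> V" "V \<subseteq> \<Omega>"
    and \<gamma>: "holomorphic_section V (ker_shift K A) \<gamma>" "\<And>w. w \<in> V \<Longrightarrow> \<gamma> w \<noteq> 0"
    and k: "k = section_curvature \<gamma> z" by blast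
  have "vholomorphic_on (\<lambda>w. U (\<gamma> w)) V"
  proof (rule vholomorphic_onI)
    fix w assume w: "w \<in> V"
    have "(\<gamma> has_derivative (\<lambda>h. h *\<^sub>C vderiv \<gamma> w)) (at w)"
      using \<gamma>(1) by (intro vholomorphic_has_derivative[OF _ V(1) w]) (simp add: holomorphic_section_def)
    from bounded_linear.has_derivative[OF cblinear_bounded_linear[OF U] this]
    show "((\<lambda>w. U (\<gamma> w)) has_derivative (\<lambda>h. h *\<^sub>C U (vderiv \<gamma> w))) (at w)"
      by (simp add: cblinear_scaleC[OF U])
  qed
  moreover have "U (\<gamma> w) \<in> ker_shift K' A' w" if "w \<in> V" for w
  proof -
    have w: "\<gamma> w \<in> K" "A (\<gamma> w) = w *\<^sub>C \<gamma> w"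
      using \<gamma>(1) that by (auto simp: holomorphic_section_def ker_shift_def)
    then have "A' (U (\<gamma> w)) = w *\<^sub>C U (\<gamma> w)"
      using A[OF w(1)] by (simp add: cblinear_scaleC[OF U])
    then show ?thesis using K[OF w(1)] by (simp add: ker_shift_def)
  qed
  moreover have "U (\<gamma> w) \<noteq> 0" if "w \<in> V" for w
    using \<gamma>(2)[OF that] norm[of "\<gamma> w"] by auto
  ultimately show ?thesis
    using V k section_curvature_isometry[OF norm, of \<gamma> z]
    by (intro exI[of _ V] exI[of _ "\<lambda>w. U (\<gamma> w)"]) (auto simp: holomorphic_section_def)
qed

text \<open>The predicates under the two definite descriptions are equivalent, as local sections are
  carried over in both directions; hence the chosen values agree at every \<open>z\<close>.\<close>

lemma curvature_unitary_invariant: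
  assumes U: "cblinear U" "\<And>x. norm (U x) = norm x" "\<And>x. x \<in> K \<Longrightarrow> U x \<in> K'"
      "\<And>x. x \<in> K \<Longrightarrow> U (A x) = A' (U x)"
    and V: "cblinear V" "\<And>x. norm (V x) = norm x" "\<And>x. x \<in> K' \<Longrightarrow> V x \<in> K"
      "\<And>x. x \<in> K' \<Longrightarrow> V (A' x) = A (V x)"
  shows "curvature \<Omega> K A z = curvature \<Omega> K' A' z"
  unfolding curvature_def
proof (rule arg_cong[where f = The], rule ext, rule iffI, goal_cases)
  case 1
  then show ?case
    by (rule curvature_local_value_transfer[rotated -1]) (fact U)+
next
  case 2
  then show ?case
    by (rule curvature_local_value_transfer[rotated -1]) (fact V)+
qed

text \<open>A unitary that respects the summands respects the splitting into diagonal and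
  superdiagonal part. The curvature is read off from the former, the quotients of norms from the
  latter.\<close>

lemma unitarily_equivalent_imp_invariants:
  assumes A: "flag n \<Omega> H D S T t" and B: "flag n \<Omega> H' D' S' T' t'"
    and equiv: "unitarily_equivalent T T'"
  shows "curvature \<Omega> (H 0) (D 0) z = curvature \<Omega> (H' 0) (D' 0) z"
    and "Suc i < n \<Longrightarrow> w \<in> \<Omega> \<Longrightarrow> norm (t i w) / norm (t (Suc i) w) = norm (t' i w) / norm (t' (Suc i) w)"
proof -
  interpret A: flag n \<Omega> H D S T t by fact
  interpret B: flag n \<Omega> H' D' S' T' t' by fact
  obtain U where U: "cblinear U" "surj U" "\<And>x y. cinner (U x) (U y) = cinner x y"
    and UT: "\<And>x. U (T x) = T' (U x)"
    using equiv unfolding unitarily_equivalent_def by blast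
  have norm: "norm (U x) = norm x" for x
  proof -
    have "(norm (U x))\<^sup>2 = (norm x)\<^sup>2"
      using U(3)[of x x] unfolding cinner_self of_real_eq_iff .
    then show ?thesis by (metis norm_ge_zero power2_eq_imp_eq)
  qed
  have "inj U"
  proof (rule injI)
    fix x y assume "U x = U y"
    then have "norm (x - y) = 0" using norm[of "x - y"] by (simp add: cblinear_diff[OF U(1)])
    then show "x = y" by simp
  qed
  define V where "V = inv U"
  have VU: "V (U x) = x" and UV: "U (V y) = y" for x y
    using \<open>inj U\<close> U(2) by (auto simp: V_def surj_f_inv_f)
  have Vnorm: "norm (V y) = norm y" for y using norm[of "V y"] by (simp add: UV)
  have V: "cblinear V"
  proof (rule cblinearI)
    show "V (x + y) = V x + V y" for x y
      by (metis UV VU cblinear_add[OF U(1)])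
    show "V (c *\<^sub>C x) = c *\<^sub>C V x" for c x
      by (metis UV VU cblinear_scaleC[OF U(1)])
    show "norm (V x) \<le> 1 * norm x" for x by (simp add: Vnorm)
  qed
  have Vinner: "cinner (V x) (V y) = cinner x y" for x y
    using U(3)[of "V x" "V y"] by (simp add: UV)
  have VT: "V (T' y) = T (V y)" for y by (metis UT UV VU)
  have UH: "U x \<in> H' j" if "j < n" "x \<in> H j" for x j
    by (rule unitary_preserves_summands[OF B A U(1) V UV VU U(3) UT that])
  have VH: "V x \<in> H j" if "j < n" "x \<in> H' j" for x j
    by (rule unitary_preserves_summands[OF A B V U(1) VU UV Vinner VT that])
  have split: "U (D j x) = D' j (U x) \<and> U (A.N x) = B.N (U x)" if j: "j < n" and x: "x \<in> H j" for j x
  proof -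
    have eq: "U (D j x) + U (A.N x) = D' j (U x) + B.N (U x)"
      using UT[of x] A.T_H[OF j x] B.T_H[OF j UH[OF j x]] by (simp add: cblinear_add[OF U(1)])
    \<comment> \<open>The shifted vectors lie in the preceding summand or vanish, so the
      \<open>j\<close>-th component isolates the diagonal part of the equation.\<close>
    have "B.Q j (U (A.N x)) = 0"
    proof (cases j)
      case (Suc k)
      then have k: "k < n" "A.N x \<in> H k" using j x A.S_in[of k x] by (auto simp: A.N_H)
      then show ?thesis using B.Q_H[OF j k(1) UH[OF k]] Suc by simp
    qed (use j x in \<open>simp add: A.N_H cblinear_zero[OF U(1)] cblinear_zero[OF B.Q_cblinear]\<close>)
    moreover have "B.Q j (B.N (U x)) = 0"
      using B.Q_H[OF _ j UH[OF j x], of "Suc j"] by (simp add: B.Q_N j B.S_zero)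
    ultimately have "B.Q j (U (D j x)) = B.Q j (D' j (U x))"
      using arg_cong[OF eq, of "B.Q j"] by (simp add: B.Q_add j)
    then have "U (D j x) = D' j (U x)"
      using j x by (simp add: B.Q_H[OF j j] UH A.D_in B.D_in)
    then show ?thesis using eq by simp
  qed
  have 0: "0 < n" using A.n2 by simp
  have "V (D' 0 y) = D 0 (V y)" if "y \<in> H' 0" for y
    using split[OF 0 VH[OF 0 that]] by (metis UV VU)
  then show "curvature \<Omega> (H 0) (D 0) z = curvature \<Omega> (H' 0) (D' 0) z"
    using split 0 by (intro curvature_unitary_invariant[of U _ _ _ _ V] U(1) V norm Vnorm UH VH) auto
  assume i: "Suc i < n" and w: "w \<in> \<Omega>"
  have "D' (Suc i) (U (t (Suc i) w)) = w *\<^sub>C U (t (Suc i) w)"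
    using split[OF i A.t_in[OF i w]] by (simp add: A.D_t[OF i w] cblinear_scaleC[OF U(1)])
  then obtain c where c: "U (t (Suc i) w) = c *\<^sub>C t' (Suc i) w"
    using B.eigenvector_multiple[OF i w UH[OF i A.t_in[OF i w]]] by blast
  \<comment> \<open>The shift hands the same scalar \<open>c\<close> down to index \<open>i\<close>,
    so \<open>c\<close> cancels in the quotient of norms.\<close>
  have "U (t i w) = B.N (U (t (Suc i) w))"
    using split[OF i A.t_in[OF i w]] by (simp add: A.N_t[OF i w])
  also have "\<dots> = c *\<^sub>C t' i w"
    by (simp add: c cblinear_scaleC[OF B.N_cblinear] B.N_t[OF i w])
  finally have c': "U (t i w) = c *\<^sub>C t' i w" .
  have "c \<noteq> 0" using c A.t_nonzero[OF i w] norm[of "t (Suc i) w"] by auto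
  moreover have "norm (t (Suc i) w) = cmod c * norm (t' (Suc i) w)" "norm (t i w) = cmod c * norm (t' i w)"
    using norm[of "t (Suc i) w"] norm[of "t i w"] by (simp_all add: c c' norm_scaleC)
  ultimately show "norm (t i w) / norm (t (Suc i) w) = norm (t' i w) / norm (t' (Suc i) w)" by simp
qed

section \<open>Construction of the unitary from equal invariants\<close>

text \<open>Orthogonality to the frame over a small open set spreads to \<open>\<Omega>\<close> by
  the identity theorem, so a set on which \<open>\<phi>\<close> exists carries enough vectors to
  determine a unitary.\<close>

lemma (in flag) frame_dense:
  assumes \<Omega>: "open \<Omega>" "connected \<Omega>" and B: "open B" "B \<noteq> {}" "B \<subseteq> \<Omega>"
    and \<phi>: "\<And>w. w \<in> B \<Longrightarrow> \<phi> w \<noteq> 0"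
  shows "closure (cspan ((\<lambda>(i, w). \<phi> w *\<^sub>C t i w) ` ({..<n} \<times> B))) = UNIV"
proof (rule dense_cspanI)
  fix x assume orth: "\<And>v. v \<in> (\<lambda>(i, w). \<phi> w *\<^sub>C t i w) ` ({..<n} \<times> B) \<Longrightarrow> cinner v x = 0"
  have "cinner (Q i x) x = 0" if i: "i < n" for i
  proof -
    have "cinner (t i w) x = 0" if "w \<in> \<Omega>" for w
    proof (rule cinner_eq_0_continuation[OF t_holomorphic[OF i] \<Omega> B _ that])
      fix w assume w: "w \<in> B"
      then have "cinner (\<phi> w *\<^sub>C t i w) x = 0" using i by (intro orth) force
      then show "cinner (t i w) x = 0" using \<phi>[OF w] by (simp add: cinner_scaleC_left)
    qed
    then show ?thesis
      using H_span[OF i] Q_in[OF i] by (auto intro: orthogonal_closure_cspan[of "t i ` \<Omega>" x])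
  qed
  then have "cinner (\<Sum>i<n. Q i x) x = 0" by (simp add: cinner_sum_left)
  then show "x = 0" by (simp flip: Q_sum)
qed

lemma invariants_imp_unitarily_equivalent:
  assumes A: "flag n \<Omega> H D S T t" and B: "flag n \<Omega> H' D' S' T' t'"
    and \<Omega>: "open \<Omega>" "connected \<Omega>"
    and curv: "\<And>z. z \<in> \<Omega> \<Longrightarrow> curvature \<Omega> (H 0) (D 0) z = curvature \<Omega> (H' 0) (D' 0) z"
    and ratio: "\<And>i w. Suc i < n \<Longrightarrow> w \<in> \<Omega> \<Longrightarrow>
       norm (t i w) / norm (t (Suc i) w) = norm (t' i w) / norm (t' (Suc i) w)"
  shows "unitarily_equivalent T T'"
proof -
  interpret A: flag n \<Omega> H D S T t by fact
  interpret B: flag n \<Omega> H' D' S' T' t' by fact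
  have 0: "0 < n" using A.n2 by simp
  obtain z where z: "z \<in> \<Omega>" using A.\<Omega>_nonempty by blast
  then obtain r where r: "r > 0" "ball z r \<subseteq> \<Omega>" using \<Omega>(1) open_contains_ball by blast
  \<comment> \<open>A disc is convex, as the construction of \<open>\<phi>\<close> demands.\<close>
  define G where "G = ball z r"
  have G: "open G" "convex G" "connected G" "G \<noteq> {}" "G \<subseteq> \<Omega>"
    using r by (auto simp: G_def convex_connected)
  note sub = vholomorphic_on_subset[OF _ G(5)]
  have "\<exists>\<phi>. \<phi> holomorphic_on G \<and> (\<forall>w\<in>G. \<phi> w \<noteq> 0 \<and> norm (t' 0 w) = cmod (\<phi> w) * norm (t 0 w))"
  proof (rule equal_curvature_norm_ratio[OF sub sub G(1,2)])
    fix w assume "w \<in> G"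
    then have w: "w \<in> \<Omega>" using G(5) by blast
    show "section_curvature (t 0) w = section_curvature (t' 0) w"
      using curv[OF w] A.curvature_frame[OF w \<Omega>(1)] B.curvature_frame[OF w \<Omega>(1)] by simp
    show "t 0 w \<noteq> 0" "t' 0 w \<noteq> 0" using A.t_nonzero[OF 0 w] B.t_nonzero[OF 0 w] .
  qed (use A.t_holomorphic B.t_holomorphic 0 in auto)
  then obtain \<phi> where \<phi>: "\<phi> holomorphic_on G" "\<And>w. w \<in> G \<Longrightarrow> \<phi> w \<noteq> 0"
    and \<phi>0: "\<And>w. w \<in> G \<Longrightarrow> norm (t' 0 w) = cmod (\<phi> w) * norm (t 0 w)" by blast
  \<comment> \<open>Equal quotients of consecutive norms pass the factor
    \<open>cmod (\<phi> w)\<close> from index 0 to every index.\<close>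
  have norm: "norm (t' i w) = cmod (\<phi> w) * norm (t i w)" if "i < n" "w \<in> G" for i w
    using that(1)
  proof (induction i)
    case (Suc i)
    have w: "w \<in> \<Omega>" using that G(5) by blast
    have i: "i < n" using Suc.prems by simp
    have "norm (t i w) \<noteq> 0" "norm (t (Suc i) w) \<noteq> 0" "norm (t' (Suc i) w) \<noteq> 0"
      using A.t_nonzero[OF i w] A.t_nonzero[OF Suc.prems w] B.t_nonzero[OF Suc.prems w] by auto
    then show ?case
      using ratio[OF Suc.prems w] Suc.IH[OF i] by (simp add: frac_eq_eq mult.commute mult.left_commute)
  qed (use \<phi>0 that in simp)
  let ?I = "{..<n} \<times> G"
  let ?v = "\<lambda>(i, w). \<phi> w *\<^sub>C t i w" and ?v' = "\<lambda>(i, w). t' i w"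
  have gram: "cinner (?v p) (?v q) = cinner (?v' p) (?v' q)" if pq: "p \<in> ?I" "q \<in> ?I" for p q
  proof -
    obtain i w j u where p: "p = (i, w)" and q: "q = (j, u)" by (cases p, cases q)
    with pq have i: "i < n" "w \<in> G" and j: "j < n" "u \<in> G" by auto
    then have w: "w \<in> \<Omega>" and u: "u \<in> \<Omega>" using G(5) by auto
    show ?thesis
    proof (cases "i = j")
      case True
      have "cinner (\<phi> w *\<^sub>C t i w) (\<phi> u *\<^sub>C t i u) = cinner (t' i w) (t' i u)"
      proof (rule holomorphic_polarization[OF _ _ G(1,3) _ i(2) j(2)])
        show "vholomorphic_on (\<lambda>w. \<phi> w *\<^sub>C t i w) G"
          by (rule vholomorphic_scaleC[OF \<phi>(1) sub[OF A.t_holomorphic[OF i(1)]] G(1)])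
        show "vholomorphic_on (t' i) G" by (rule sub[OF B.t_holomorphic[OF i(1)]])
        show "norm (\<phi> w *\<^sub>C t i w) = norm (t' i w)" if "w \<in> G" for w
          using norm[OF i(1) that] by (simp add: norm_scaleC)
      qed
      then show ?thesis by (simp add: p q True)
    next
      case False
      then show ?thesis
        using A.H_orthogonal[OF i(1) j(1) False A.t_in[OF i(1) w] A.t_in[OF j(1) u]]
          B.H_orthogonal[OF i(1) j(1) False B.t_in[OF i(1) w] B.t_in[OF j(1) u]]
        by (simp add: p q cinner_scaleC_left cinner_scaleC_right)
    qed
  qed
  have dense: "closure (cspan (?v ` ?I)) = UNIV"
    by (rule A.frame_dense[OF \<Omega> G(1,4,5) \<phi>(2)])
  have "closure (cspan ((\<lambda>(i, w). 1 *\<^sub>C t' i w) ` ?I)) = UNIV"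
    by (rule B.frame_dense[OF \<Omega> G(1,4,5)]) simp
  then have dense': "closure (cspan (?v' ` ?I)) = UNIV" by (simp add: scaleC_one)
  obtain U where U: "cblinear U" "surj U" "\<And>x y. cinner (U x) (U y) = cinner x y"
    and Uv: "\<And>p. p \<in> ?I \<Longrightarrow> U (?v p) = ?v' p"
    using equal_gram_unitary[OF gram dense dense'] by blast
  have Ut: "U (\<phi> w *\<^sub>C t i w) = t' i w" if "i < n" "w \<in> G" for i w
    using Uv[of "(i, w)"] that by simp
  have "U (T x) = T' (U x)" for x
  proof (rule cblinear_eq_on_closure_cspan[OF cblinear_compose[OF U(1) A.T_cblinear]
        cblinear_compose[OF B.T_cblinear U(1)], of "?v ` ?I"])
    fix v assume "v \<in> ?v ` ?I"
    then obtain i w where iw: "i < n" "w \<in> G" and v: "v = \<phi> w *\<^sub>C t i w" by auto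
    have w: "w \<in> \<Omega>" using iw G(5) by blast
    \<comment> \<open>Both terms carry the same factor \<open>\<phi> w\<close>, so \<open>U\<close>
      takes them to \<open>t' i w\<close> and \<open>t' (i - 1) w\<close> with the coefficients that
      \<open>T'\<close> has.\<close>
    have "T v = w *\<^sub>C (\<phi> w *\<^sub>C t i w) + (if i = 0 then 0 else \<phi> w *\<^sub>C t (i - 1) w)"
      by (simp add: v cblinear_scaleC[OF A.T_cblinear] A.T_t[OF iw(1) w] A.N_t[OF iw(1) w]
          scaleC_add_right scaleC_scaleC mult.commute)
    moreover have "U ((w * \<phi> w) *\<^sub>C t i w) = w *\<^sub>C t' i w"
      using cblinear_scaleC[OF U(1), of w "\<phi> w *\<^sub>C t i w"] Ut[OF iw] by (simp add: scaleC_scaleC)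
    ultimately have "U (T v) = w *\<^sub>C t' i w + (if i = 0 then 0 else t' (i - 1) w)"
      using iw by (simp add: scaleC_scaleC cblinear_add[OF U(1)] Ut cblinear_zero[OF U(1)])
    also have "\<dots> = T' (U v)"
      using iw by (simp add: v Ut B.T_t[OF iw(1) w] B.N_t[OF iw(1) w])
    finally show "U (T v) = T' (U v)" .
  qed (simp add: dense)
  then show ?thesis using U unfolding unitarily_equivalent_def by blast
qed

theorem theorem2:
  fixes \<Omega> :: "complex set" and n :: nat
    and H :: "nat \<Rightarrow> 'a::separable_hilbert set"
    and D :: "nat \<Rightarrow> 'a \<Rightarrow> 'a" and S :: "nat \<Rightarrow> nat \<Rightarrow> 'a \<Rightarrow> 'a"
    and T :: "'a \<Rightarrow> 'a" and t :: "nat \<Rightarrow> complex \<Rightarrow> 'a"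
    and H' :: "nat \<Rightarrow> 'b::separable_hilbert set"
    and D' :: "nat \<Rightarrow> 'b \<Rightarrow> 'b" and S' :: "nat \<Rightarrow> nat \<Rightarrow> 'b \<Rightarrow> 'b"
    and T' :: "'b \<Rightarrow> 'b" and t' :: "nat \<Rightarrow> complex \<Rightarrow> 'b"
  assumes "open \<Omega>" and "connected \<Omega>" and "2 \<le> n"
    and "flag_operator n \<Omega> H D S T" and "flag_operator n \<Omega> H' D' S' T'"
    and "flag_frame n \<Omega> H D S t" and "flag_frame n \<Omega> H' D' S' t'"
  shows "unitarily_equivalent T T' \<longleftrightarrow>
    (\<forall>z\<in>\<Omega>. curvature \<Omega> (H 0) (D 0) z = curvature \<Omega> (H' 0) (D' 0) z) \<and>
    (\<forall>i\<in>{1..n - 1}. \<forall>w\<in>\<Omega>.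
       (norm (S (i - 1) i (t i w)))\<^sup>2 / (norm (t i w))\<^sup>2 =
       (norm (S' (i - 1) i (t' i w)))\<^sup>2 / (norm (t' i w))\<^sup>2)"
proof -
  have A: "flag n \<Omega> H D S T t" and B: "flag n \<Omega> H' D' S' T' t'"
    using assms by (auto intro: flag.intro)
  interpret A: flag n \<Omega> H D S T t by fact
  interpret B: flag n \<Omega> H' D' S' T' t' by fact
  have ratio: "(norm (S (Suc i - 1) (Suc i) (t (Suc i) w)))\<^sup>2 / (norm (t (Suc i) w))\<^sup>2 =
       (norm (S' (Suc i - 1) (Suc i) (t' (Suc i) w)))\<^sup>2 / (norm (t' (Suc i) w))\<^sup>2 \<longleftrightarrow>
       norm (t i w) / norm (t (Suc i) w) = norm (t' i w) / norm (t' (Suc i) w)"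
    if "Suc i < n" "w \<in> \<Omega>" for i w
    using that by (simp add: A.S_t B.S_t flip: power_divide)
  have index: "i \<in> {1..n - 1} \<longleftrightarrow> (\<exists>k. i = Suc k \<and> Suc k < n)" for i
    by (cases i) auto
  show ?thesis
  proof (intro iffI conjI ballI)
    assume equiv: "unitarily_equivalent T T'"
    note inv = unitarily_equivalent_imp_invariants[OF A B equiv]
    show "curvature \<Omega> (H 0) (D 0) z = curvature \<Omega> (H' 0) (D' 0) z" for z by (rule inv(1))
    fix i w assume "i \<in> {1..n - 1}" and w: "w \<in> \<Omega>"
    then obtain k where k: "i = Suc k" "Suc k < n" unfolding index by blast
    show "(norm (S (i - 1) i (t i w)))\<^sup>2 / (norm (t i w))\<^sup>2 =
       (norm (S' (i - 1) i (t' i w)))\<^sup>2 / (norm (t' i w))\<^sup>2"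
      unfolding k(1) ratio[OF k(2) w] by (rule inv(2)[OF k(2) w])
  next
    assume inv: "(\<forall>z\<in>\<Omega>. curvature \<Omega> (H 0) (D 0) z = curvature \<Omega> (H' 0) (D' 0) z) \<and>
      (\<forall>i\<in>{1..n - 1}. \<forall>w\<in>\<Omega>. (norm (S (i - 1) i (t i w)))\<^sup>2 / (norm (t i w))\<^sup>2 =
       (norm (S' (i - 1) i (t' i w)))\<^sup>2 / (norm (t' i w))\<^sup>2)"
    show "unitarily_equivalent T T'"
    proof (rule invariants_imp_unitarily_equivalent[OF A B \<open>open \<Omega>\<close> \<open>connected \<Omega>\<close>])
      show "curvature \<Omega> (H 0) (D 0) z = curvature \<Omega> (H' 0) (D' 0) z" if "z \<in> \<Omega>" for z
        using inv that by blast
      fix i w assume iw: "Suc i < n" "w \<in> \<Omega>"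
      then have "Suc i \<in> {1..n - 1}" unfolding index by blast
      then show "norm (t i w) / norm (t (Suc i) w) = norm (t' i w) / norm (t' (Suc i) w)"
        unfolding ratio[OF iw, symmetric] using inv iw(2) by blast
    qed
  qed
qed

end
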